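(* For $1\le p<2$, there exist positive constants $c$ and $C$, depending only on $p$, such that $$c\,n^{\frac32-\frac1p}\le K_G(\ell_p^n,\ell_p^n)\le C\,n^{\frac32-\frac1p}\qquad\text{for all } n\ge1.$$
   Context: All Banach spaces are real. For $E$ finite-dimensional and $F$ a Banach space, $$K_G(E,F)=\sup\{\|A\otimes\mathrm{id}_F\|_{E\check\otimes F\to E^*\hat\otimes F}:\ A:E\to E^*\text{ linear},\ \|A\|_{E\to E^*}\le1\},$$ with $\check\otimes$, $\hat\otimes$ the injective and projective tensor products. *)

theory Defs
  imports "HOL-Analysis.Analysis" "HOL-Library.Function_Algebras"
begin

instantiation "fun" :: (type, real_vector) real_vector
begin

definition scaleR_fun :: "real \<Rightarrow> ('a \<Rightarrow> 'b) \<Rightarrow> 'a \<Rightarrow> 'b"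
  where "scaleR_fun r f = (\<lambda>x. r *\<^sub>R f x)"

instance
  by standard (simp_all add: scaleR_fun_def plus_fun_def fun_eq_iff algebra_simps)

end

lemma scaleR_fun_apply [simp]: "(r *\<^sub>R f) x = r *\<^sub>R f x"
  by (simp add: scaleR_fun_def)

text \<open>A real normed space is given by a linear subspace of an ambient real vector space
  together with a norm on it (the values of the norm off the subspace are irrelevant).
  The dimension is thereby an ordinary parameter, not part of a type.\<close>

record 'a nspace =
  vecs :: "'a set"
  nrm :: "'a \<Rightarrow> real"

definition linear_on :: "'a::real_vector set \<Rightarrow> ('a \<Rightarrow> 'b::real_vector) \<Rightarrow> bool" where
  "linear_on S f \<longleftrightarrow>
     (\<forall>x\<in>S. \<forall>y\<in>S. f (x + y) = f x + f y) \<and> (\<forall>r. \<forall>x\<in>S. f (r *\<^sub>R x) = r *\<^sub>R f x)"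

definition linear_maps ::
    "'a::real_vector nspace \<Rightarrow> 'b::real_vector nspace \<Rightarrow> ('a \<Rightarrow> 'b) set" where
  "linear_maps E F = {A. linear_on (vecs E) A \<and> A ` vecs E \<subseteq> vecs F}"

text \<open>The operator norm is an extended nonnegative number, so that it is infinite for an
  unbounded operator and its finiteness is part of any upper bound.\<close>

definition op_norm :: "'a nspace \<Rightarrow> 'b nspace \<Rightarrow> ('a \<Rightarrow> 'b) \<Rightarrow> ennreal" where
  "op_norm E F A = (SUP x\<in>{x\<in>vecs E. nrm E x \<le> 1}. ennreal (nrm F (A x)))"

text \<open>Functionals are set to 0 outside the space, so that those that agree on the space are equal.\<close>

definition dual_space :: "'a::real_vector nspace \<Rightarrow> ('a \<Rightarrow> real) nspace" where
  "dual_space E =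
     \<lparr>vecs = {f. linear_on (vecs E) f \<and> (\<exists>K. \<forall>x\<in>vecs E. \<bar>f x\<bar> \<le> K * nrm E x) \<and>
                 (\<forall>x. x \<notin> vecs E \<longrightarrow> f x = 0)},
      nrm = (\<lambda>f. SUP x\<in>{x\<in>vecs E. nrm E x \<le> 1}. \<bar>f x\<bar>)\<rparr>"

text \<open>The algebraic tensor product of \<open>S\<close> and \<open>T\<close> is realised inside the linear functionals on
  the bilinear forms on \<open>S \<times> T\<close>: the elementary tensor of \<open>x\<close> and \<open>y\<close> is evaluation at
  \<open>(x, y)\<close>, and general tensors are finite sums of elementary ones. Arguments that are not
  bilinear forms are sent to 0, so that two tensors are equal iff they agree on all bilinear
  forms.\<close>

definition bilinear_on ::
    "'a::real_vector set \<Rightarrow> 'b::real_vector set \<Rightarrow> ('a \<Rightarrow> 'b \<Rightarrow> real) \<Rightarrow> bool" where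
  "bilinear_on S T B \<longleftrightarrow>
     (\<forall>y\<in>T. linear_on S (\<lambda>x. B x y)) \<and> (\<forall>x\<in>S. linear_on T (B x))"

type_synonym ('a, 'b) tensor = "('a \<Rightarrow> 'b \<Rightarrow> real) \<Rightarrow> real"

definition elem_tensor ::
    "'a::real_vector set \<Rightarrow> 'b::real_vector set \<Rightarrow> 'a \<Rightarrow> 'b \<Rightarrow> ('a, 'b) tensor" where
  "elem_tensor S T x y = (\<lambda>B. if bilinear_on S T B then B x y else 0)"

definition tensors ::
    "'a::real_vector set \<Rightarrow> 'b::real_vector set \<Rightarrow> ('a, 'b) tensor set" where
  "tensors S T = span {elem_tensor S T x y | x y. x \<in> S \<and> y \<in> T}"

text \<open>The injective and projective tensor products. No completion is taken: when \<open>E\<close> is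
  finite-dimensional and \<open>F\<close> is a Banach space, the algebraic tensor product is already
  complete in both norms.\<close>

definition inj_tensor ::
    "'a::real_vector nspace \<Rightarrow> 'b::real_vector nspace \<Rightarrow> ('a, 'b) tensor nspace" where
  "inj_tensor E F =
     \<lparr>vecs = tensors (vecs E) (vecs F),
      nrm = (\<lambda>u. Sup {\<bar>u (\<lambda>x y. \<phi> x * \<psi> y)\<bar> | \<phi> \<psi>.
                   \<phi> \<in> vecs (dual_space E) \<and> nrm (dual_space E) \<phi> \<le> 1 \<and>
                   \<psi> \<in> vecs (dual_space F) \<and> nrm (dual_space F) \<psi> \<le> 1})\<rparr>"

definition proj_tensor ::
    "'a::real_vector nspace \<Rightarrow> 'b::real_vector nspace \<Rightarrow> ('a, 'b) tensor nspace" where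
  "proj_tensor E F =
     \<lparr>vecs = tensors (vecs E) (vecs F),
      nrm = (\<lambda>u. Inf {(\<Sum>i<k. nrm E (x i) * nrm F (y i)) | (k::nat) x y.
                   (\<forall>i<k. x i \<in> vecs E \<and> y i \<in> vecs F) \<and>
                   u = (\<Sum>i<k. elem_tensor (vecs E) (vecs F) (x i) (y i))})\<rparr>"

text \<open>The tensor product of linear maps \<open>A : E \<rightarrow> G\<close> and \<open>T : F \<rightarrow> H\<close>; see
  \<open>tensor_map_elem\<close> below.\<close>

definition tensor_map ::
    "'c::real_vector nspace \<Rightarrow> 'd::real_vector nspace \<Rightarrow> ('a \<Rightarrow> 'c) \<Rightarrow> ('b \<Rightarrow> 'd) \<Rightarrow>
     ('a, 'b) tensor \<Rightarrow> ('c, 'd) tensor" where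
  "tensor_map G H A T u =
     (\<lambda>B. if bilinear_on (vecs G) (vecs H) B then u (\<lambda>x y. B (A x) (T y)) else 0)"

lemma tensor_map_elem:
  assumes "A \<in> linear_maps E G" "T \<in> linear_maps F H"
  shows "tensor_map G H A T (elem_tensor (vecs E) (vecs F) x y) =
         elem_tensor (vecs G) (vecs H) (A x) (T y)"
proof -
  have "bilinear_on (vecs E) (vecs F) (\<lambda>x y. B (A x) (T y))"
    if "bilinear_on (vecs G) (vecs H) B" for B
    using assms that unfolding bilinear_on_def linear_maps_def linear_on_def
    by (auto simp: image_subset_iff)
  then show ?thesis
    by (auto simp: tensor_map_def elem_tensor_def fun_eq_iff)
qed

lemma tensor_map_linear:
  "tensor_map G H A T (u + v) = tensor_map G H A T u + tensor_map G H A T v"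
  "tensor_map G H A T (r *\<^sub>R u) = r *\<^sub>R tensor_map G H A T u"
  by (auto simp: tensor_map_def fun_eq_iff)

definition K_G :: "'a::real_vector nspace \<Rightarrow> 'b::real_vector nspace \<Rightarrow> ennreal" where
  "K_G E F =
     (SUP A\<in>{A \<in> linear_maps E (dual_space E). op_norm E (dual_space E) A \<le> 1}.
        op_norm (inj_tensor E F) (proj_tensor (dual_space E) F)
          (tensor_map (dual_space E) F A id))"

text \<open>\<open>\<ell>\<^sub>p\<^sup>n\<close> for real \<open>p \<ge> 1\<close>; the coordinates are indexed by \<open>0, \<dots>, n - 1\<close>.\<close>

definition lp_space :: "real \<Rightarrow> nat \<Rightarrow> (nat \<Rightarrow> real) nspace" where
  "lp_space p n =
     \<lparr>vecs = {x. \<forall>i\<ge>n. x i = 0},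
      nrm = (\<lambda>x. (\<Sum>i<n. \<bar>x i\<bar> powr p) powr (1 / p))\<rparr>"

end

theory Submission
  imports Defs
begin

text \<open>Write \<open>E = \<ell>\<^sub>p\<^sup>n\<close>; its dual is \<open>\<ell>\<^sub>q\<^sup>n\<close> with \<open>1 / p + 1 / q = 1\<close>, and tensors are
  \<open>n \<times> n\<close> matrices.

  For the upper bound, let \<open>u\<close> have injective norm at most 1 and columns \<open>u\<^sub>j\<close>. If \<open>A\<close> is a contraction
  from \<open>E\<close> to its dual, the image of \<open>u\<close> is the sum of \<open>A u\<^sub>j \<otimes> e\<^sub>j\<close>, so its projective norm is at most
  the sum of the \<open>\<ell>\<^sub>p\<close> norms of the columns, hence at most \<open>n powr (1 / p - 1 / 2)\<close> times the sum of their
  \<open>\<ell>\<^sub>2\<close> norms. By the Khintchine inequality (\<open>khintchine_L1\<close>) the latter sum is, up to a constant, the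
  average over signs \<open>s\<close> of the sum over \<open>j\<close> of \<open>\<bar>\<langle>s, u\<^sub>j\<rangle>\<bar>\<close>, and for each \<open>s\<close> this is a value of \<open>u\<close> on
  two sign vectors, whose norm in \<open>\<ell>\<^sub>q\<^sup>n\<close> is \<open>n powr (1 - 1 / p)\<close> (\<open>inj_norm_signed_columns\<close>). Altogether the
  exponent is \<open>(1 / p - 1 / 2) + (2 - 2 / p) = 3 / 2 - 1 / p\<close>.

  For the lower bound, take for both \<open>A\<close> and \<open>u\<close> suitable multiples of the Hartley matrix \<open>H\<close>, which is
  symmetric with bounded entries and satisfies \<open>H\<^sup>2 = n I\<close>. Its injective norm is easily bounded through
  \<open>\<ell>\<^sub>2\<close>. The norm of \<open>H\<close> as an operator from \<open>\<ell>\<^sub>p\<^sup>n\<close> to \<open>\<ell>\<^sub>q\<^sup>n\<close> is of order \<open>n powr (1 - 1 / p)\<close>; this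
  discrete Hausdorff--Young inequality (\<open>bilinear_form_bound\<close>), obtained by interpolation between the
  trivial bounds on \<open>\<ell>\<^sub>1\<close> and \<open>\<ell>\<^sub>2\<close>, is the main analytic ingredient. Pairing the image of \<open>u\<close> with the identity
  gives the trace of a multiple of \<open>H\<^sup>2\<close>, which has the required size (\<open>K_G_lp_lower\<close>).\<close>

section \<open>Comparison of power sums\<close>

text \<open>The second derivative gives convexity only on the open half-line; at the endpoint 0 the
  inequality reduces to \<open>t powr p \<le> t\<close>. The endpoint matters because coordinates of vectors
  may vanish.\<close>

lemma powr_convex_nonneg:
  assumes "p \<ge> 1"
  shows "convex_on {0..} (\<lambda>x::real. x powr p)"
proof (rule convex_onI)
  have scale: "(t * x) powr p \<le> t * x powr p" if "0 < t" "t < 1" "0 \<le> x" for t x :: real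
  proof -
    have "t powr p \<le> t powr 1"
      using that assms by (intro powr_mono') auto
    then show ?thesis
      using that by (simp add: powr_mult mult_right_mono)
  qed
  fix t x y :: real
  assume t: "0 < t" "t < 1" and xy: "x \<in> {0..}" "y \<in> {0..}"
  show "((1 - t) *\<^sub>R x + t *\<^sub>R y) powr p \<le> (1 - t) * x powr p + t * y powr p"
  proof (cases "x = 0 \<or> y = 0")
    case True
    then show ?thesis
      using scale[of t y] scale[of "1 - t" x] t xy assms by auto
  next
    case False
    then show ?thesis
      using convex_onD[OF powr_convex[OF assms], of t x y] t xy by auto
  qed
qed simp

text \<open>Jensen's inequality for \<open>z powr (s / r)\<close>, applied to the uniform average of the numbers
  \<open>a i powr r\<close>. It yields the comparison of \<open>\<ell>\<^sub>1\<close>, \<open>\<ell>\<^sub>p\<close> and \<open>\<ell>\<^sub>2\<close> norms in dimension \<open>n\<close>.\<close>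

lemma power_mean_ineq:
  fixes a :: "'i \<Rightarrow> real"
  assumes "finite S" "0 < r" "r \<le> s" and a: "\<And>i. i \<in> S \<Longrightarrow> 0 \<le> a i"
  shows "(\<Sum>i\<in>S. a i powr r) powr (1 / r)
    \<le> real (card S) powr (1 / r - 1 / s) * (\<Sum>i\<in>S. a i powr s) powr (1 / s)"
proof (cases "S = {}")
  case False
  define n where "n = real (card S)"
  have n: "n > 0" using False assms(1) by (simp add: n_def card_gt_0_iff)
  define P where "P = (\<Sum>i\<in>S. a i powr r)"
  define Q where "Q = (\<Sum>i\<in>S. a i powr s)"
  have P0: "P \<ge> 0" and Q0: "Q \<ge> 0" by (auto simp: P_def Q_def intro: sum_nonneg)
  have "(\<Sum>i\<in>S. (1/n) *\<^sub>R (a i powr r)) powr (s / r) \<le> (\<Sum>i\<in>S. (1/n) * (a i powr r) powr (s / r))"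
    using n assms False
    by (intro convex_on_sum[OF _ _ powr_convex_nonneg]) (auto simp: n_def)
  also have "\<dots> = Q / n"
    using assms by (simp add: powr_powr sum_divide_distrib Q_def)
  finally have "(P / n) powr (s / r) \<le> Q / n"
    by (simp add: P_def sum_divide_distrib)
  then have "((P / n) powr (s / r)) powr (1 / s) \<le> (Q / n) powr (1 / s)"
    using assms by (intro powr_mono2) auto
  then have "P powr (1 / r) / n powr (1 / r) \<le> Q powr (1 / s) / n powr (1 / s)"
    using assms P0 Q0 n by (simp add: powr_powr powr_divide)
  then show ?thesis
    using n by (simp add: P_def Q_def n_def powr_diff field_simps)
qed simp

section \<open>Rademacher averages and the Khintchine inequality\<close>

text \<open>The expectation over independent uniform signs \<open>s 0, \<dots>, s (n - 1)\<close>. Averaging one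
  coordinate at a time turns every moment computation into an induction on \<open>n\<close>. The base value 1
  makes each sample a sequence of signs on all of \<open>nat\<close>.\<close>

primrec rademacher_mean :: "nat \<Rightarrow> ((nat \<Rightarrow> real) \<Rightarrow> real) \<Rightarrow> real" where
  "rademacher_mean 0 f = f (\<lambda>_. 1)"
| "rademacher_mean (Suc n) f =
    (rademacher_mean n (\<lambda>s. f (s(n := 1))) + rademacher_mean n (\<lambda>s. f (s(n := -1)))) / 2"

lemma rademacher_mean_add:
  "rademacher_mean n (\<lambda>s. f s + g s) = rademacher_mean n f + rademacher_mean n g"
  by (induction n arbitrary: f g) (simp_all add: field_simps)

lemma rademacher_mean_cmult:
  "rademacher_mean n (\<lambda>s. c * f s) = c * rademacher_mean n f"
  by (induction n arbitrary: f) (simp_all add: field_simps)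

lemma rademacher_mean_const: "rademacher_mean n (\<lambda>s. c) = c"
  by (induction n) simp_all

lemma rademacher_mean_sum:
  "rademacher_mean n (\<lambda>s. \<Sum>j<m. f j s) = (\<Sum>j<(m::nat). rademacher_mean n (f j))"
  by (induction m) (simp_all add: rademacher_mean_const rademacher_mean_add)

lemma rademacher_mean_mono:
  assumes "\<And>s. (\<And>i. \<bar>s i\<bar> = 1) \<Longrightarrow> f s \<le> g s"
  shows "rademacher_mean n f \<le> rademacher_mean n g"
  using assms
proof (induction n arbitrary: f g)
  case (Suc n)
  have "rademacher_mean n (\<lambda>s. f (s(n := e))) \<le> rademacher_mean n (\<lambda>s. g (s(n := e)))"
    if "\<bar>e\<bar> = 1" for e :: real
    using that by (intro Suc.IH Suc.prems) auto
  from this[of 1] this[of "-1"] show ?case by simp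
qed simp

lemma sum_upd_above:
  "(\<Sum>i<(n::nat). (s(n := e)) i * c i) = (\<Sum>i<n. s i * c i :: real)"
  by (intro sum.cong) auto

text \<open>Averaging \<open>(S + c)\<^sup>2\<close> and \<open>(S - c)\<^sup>2\<close> cancels the cross term.\<close>

lemma rademacher_mean_square:
  "rademacher_mean n (\<lambda>s. (\<Sum>i<n. s i * c i)\<^sup>2) = (\<Sum>i<n. (c i)\<^sup>2)"
proof (induction n)
  case (Suc n)
  let ?S = "\<lambda>s. \<Sum>i<n. s i * c i"
  have "rademacher_mean (Suc n) (\<lambda>s. (\<Sum>i<Suc n. s i * c i)\<^sup>2)
      = (rademacher_mean n (\<lambda>s. (?S s + c n)\<^sup>2) + rademacher_mean n (\<lambda>s. (?S s - c n)\<^sup>2)) / 2"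
    by (simp only: rademacher_mean.simps sum.lessThan_Suc sum_upd_above) simp
  also have "\<dots> = rademacher_mean n (\<lambda>s. ((?S s + c n)\<^sup>2 + (?S s - c n)\<^sup>2) * (1/2))"
    unfolding mult.commute[of _ "1/2::real"] by (simp only: rademacher_mean_add rademacher_mean_cmult)
  also have "(\<lambda>s. ((?S s + c n)\<^sup>2 + (?S s - c n)\<^sup>2) * (1/2)) = (\<lambda>s. (?S s)\<^sup>2 + (c n)\<^sup>2)"
    by (simp add: fun_eq_iff power2_eq_square algebra_simps)
  finally show ?case by (simp add: rademacher_mean_add rademacher_mean_const Suc.IH)
qed simp

text \<open>Averaging \<open>(S + c) ^ 4\<close> and \<open>(S - c) ^ 4\<close> leaves \<open>S ^ 4 + 6 c\<^sup>2 S\<^sup>2 + c ^ 4\<close>. With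
  \<open>v\<close> the second moment of \<open>S\<close>, the bound is inductive since
  \<open>3 v\<^sup>2 + 6 c\<^sup>2 v + c ^ 4 \<le> 3 (v + c\<^sup>2)\<^sup>2\<close>.\<close>

lemma rademacher_mean_fourth:
  "rademacher_mean n (\<lambda>s. (\<Sum>i<n. s i * c i) ^ 4) \<le> 3 * (\<Sum>i<n. (c i)\<^sup>2)\<^sup>2"
proof (induction n)
  case (Suc n)
  let ?S = "\<lambda>s. \<Sum>i<n. s i * c i"
  let ?v = "\<Sum>i<n. (c i)\<^sup>2"
  have "rademacher_mean (Suc n) (\<lambda>s. (\<Sum>i<Suc n. s i * c i) ^ 4)
      = (rademacher_mean n (\<lambda>s. (?S s + c n) ^ 4) + rademacher_mean n (\<lambda>s. (?S s - c n) ^ 4)) / 2"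
    by (simp only: rademacher_mean.simps sum.lessThan_Suc sum_upd_above) simp
  also have "\<dots> = rademacher_mean n (\<lambda>s. ((?S s + c n) ^ 4 + (?S s - c n) ^ 4) * (1/2))"
    unfolding mult.commute[of _ "1/2::real"] by (simp only: rademacher_mean_add rademacher_mean_cmult)
  also have "(\<lambda>s. ((?S s + c n) ^ 4 + (?S s - c n) ^ 4) * (1/2))
      = (\<lambda>s. ?S s ^ 4 + (6 * (c n)\<^sup>2 * (?S s)\<^sup>2 + c n ^ 4))"
    by (simp add: fun_eq_iff power2_eq_square power4_eq_xxxx algebra_simps)
  finally have "rademacher_mean (Suc n) (\<lambda>s. (\<Sum>i<Suc n. s i * c i) ^ 4)
      = rademacher_mean n (\<lambda>s. ?S s ^ 4) + (6 * (c n)\<^sup>2 * ?v + c n ^ 4)"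
    by (simp add: rademacher_mean_add rademacher_mean_cmult rademacher_mean_const
        rademacher_mean_square)
  also have "\<dots> \<le> 3 * ?v\<^sup>2 + (6 * (c n)\<^sup>2 * ?v + 3 * c n ^ 4)"
    using Suc.IH zero_le_even_power[OF even_numeral, of "c n" "num.Bit0 num.One"] by linarith
  also have "\<dots> = 3 * (\<Sum>i<Suc n. (c i)\<^sup>2)\<^sup>2"
    by (simp add: power2_eq_square power4_eq_xxxx algebra_simps)
  finally show ?case .
qed simp

text \<open>A lower bound for the first moment follows from the exact second moment and the bound on the
  fourth, by integrating a pointwise inequality of the form \<open>\<bar>S\<bar> \<ge> S\<^sup>2 - b S ^ 4\<close>, here
  stated in the scaling where \<open>S\<close> has standard deviation \<open>\<sigma>\<close>.\<close>

lemma khintchine_L1: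
  "sqrt (\<Sum>i<n. (c i)\<^sup>2) \<le> 9 / 5 * rademacher_mean n (\<lambda>s. \<bar>\<Sum>i<n. s i * c i\<bar>)"
proof -
  define \<sigma> where "\<sigma> = sqrt (\<Sum>i<n. (c i)\<^sup>2)"
  define S where "S = (\<lambda>s. \<Sum>i<n. s i * c i)"
  have \<sigma>2: "\<sigma>\<^sup>2 = (\<Sum>i<n. (c i)\<^sup>2)" and \<sigma>0: "\<sigma> \<ge> 0"
    by (auto simp: \<sigma>_def sum_nonneg)
  show ?thesis
  proof (cases "\<sigma> = 0")
    case True
    have "rademacher_mean n (\<lambda>s. 0) \<le> rademacher_mean n (\<lambda>s. \<bar>S s\<bar>)"
      by (intro rademacher_mean_mono) simp
    then show ?thesis
      using True unfolding \<sigma>_def[symmetric] S_def by (simp add: rademacher_mean_const)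
  next
    case False
    with \<sigma>0 have \<sigma>: "\<sigma> > 0" by simp
    \<comment> \<open>The constant \<open>4 / 27\<close> makes the cubic \<open>(4 / 27) t ^ 3 - t + 1\<close> have a double zero at
      \<open>t = 3 / 2\<close>, hence nonnegative on the half-line; the claim is its instance at \<open>t / \<sigma>\<close>,
      multiplied by \<open>\<sigma> ^ 3 * t\<close>.\<close>
    have pt: "\<sigma> ^ 2 * t ^ 2 - 4 / 27 * t ^ 4 \<le> \<sigma> ^ 3 * t" if "t \<ge> 0" for t
    proof -
      have "0 \<le> 4 / 27 * t * (t - 3 / 2 * \<sigma>)\<^sup>2 * (t + 3 * \<sigma>)"
        using that \<sigma> by simp
      also have "\<dots> = \<sigma> ^ 3 * t - (\<sigma> ^ 2 * t ^ 2 - 4 / 27 * t ^ 4)"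
        by (simp add: power2_eq_square power3_eq_cube power4_eq_xxxx field_simps)
      finally show ?thesis by simp
    qed
    have "rademacher_mean n (\<lambda>s. \<sigma> ^ 2 * (S s) ^ 2 + (- (4 / 27)) * (S s) ^ 4)
        \<le> rademacher_mean n (\<lambda>s. \<sigma> ^ 3 * \<bar>S s\<bar>)"
      using pt[of "\<bar>S _\<bar>"] by (intro rademacher_mean_mono) simp
    then have "\<sigma> ^ 2 * rademacher_mean n (\<lambda>s. (S s) ^ 2)
          + (- (4 / 27)) * rademacher_mean n (\<lambda>s. (S s) ^ 4)
        \<le> \<sigma> ^ 3 * rademacher_mean n (\<lambda>s. \<bar>S s\<bar>)"
      by (simp only: rademacher_mean_add rademacher_mean_cmult)
    moreover have "rademacher_mean n (\<lambda>s. (S s) ^ 2) = \<sigma>\<^sup>2"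
      by (simp only: S_def rademacher_mean_square \<sigma>2)
    moreover have "rademacher_mean n (\<lambda>s. (S s) ^ 4) \<le> 3 * \<sigma> ^ 4"
      using rademacher_mean_fourth[of n c] by (simp add: S_def flip: \<sigma>2)
    ultimately have "5 / 9 * \<sigma> ^ 4 \<le> \<sigma> ^ 3 * rademacher_mean n (\<lambda>s. \<bar>S s\<bar>)"
      by (simp add: power2_eq_square power4_eq_xxxx)
    then have "\<sigma> ^ 3 * (5 / 9 * \<sigma>) \<le> \<sigma> ^ 3 * rademacher_mean n (\<lambda>s. \<bar>S s\<bar>)"
      by (simp add: power3_eq_cube power4_eq_xxxx mult_ac)
    then have "5 / 9 * \<sigma> \<le> rademacher_mean n (\<lambda>s. \<bar>S s\<bar>)"
      using \<sigma> by (subst (asm) mult_le_cancel_left_pos) auto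
    then show ?thesis by (simp add: \<sigma>_def S_def)
  qed
qed

section \<open>The Hartley matrix\<close>

text \<open>The real form of the discrete Fourier transform: up to the factor \<open>sqrt n\<close>, a real
  orthogonal matrix whose entries all have modulus at most of order \<open>1 / sqrt n\<close>. It exists in
  every dimension.\<close>

definition hartley :: "nat \<Rightarrow> nat \<Rightarrow> nat \<Rightarrow> real" where
  "hartley n i j = cos (2 * pi * real i * real j / real n) + sin (2 * pi * real i * real j / real n)"

lemma abs_hartley_le: "\<bar>hartley n i j\<bar> \<le> 2"
  unfolding hartley_def by (rule order_trans[OF abs_triangle_ineq]) (smt (verit) abs_cos_le_one abs_sin_le_one)

lemma sum_cis_root_unity:
  fixes m :: int
  assumes "n \<ge> 1"
  shows "(\<Sum>k<n. cis (2 * pi * m * real k / real n)) = (if int n dvd m then of_nat n else 0)"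
proof -
  define z where "z = cis (2 * pi * m / real n)"
  have zk: "cis (2 * pi * m * real k / real n) = z ^ k" for k
    unfolding z_def Complex.DeMoivre by (rule arg_cong[where f = cis]) simp
  have zn: "z ^ n = 1"
    unfolding z_def Complex.DeMoivre using assms cis_multiple_2pi[of "real_of_int m"] by (simp add: mult_ac)
  have "z = 1 \<longleftrightarrow> int n dvd m"
  proof
    assume "z = 1"
    then have "cos (2 * pi * m / real n) = 1"
      by (simp add: z_def complex_eq_iff)
    then obtain k :: int where "2 * pi * m / real n = k * 2 * pi"
      by (auto simp: cos_one_2pi_int)
    then have "real_of_int m = real_of_int (int n * k)"
      using assms by (simp add: field_simps)
    then show "int n dvd m"
      by (metis dvd_triv_left of_int_eq_iff)
  next
    assume "int n dvd m"
    then obtain k where "m = int n * k" ..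
    then show "z = 1"
      unfolding z_def using assms cis_multiple_2pi[of "real_of_int k"] by (simp add: mult_ac)
  qed
  then show ?thesis
    using zn by (auto simp: zk geometric_sum)
qed

text \<open>By \<open>(cos a + sin a) (cos b + sin b) = cos (a - b) + sin (a + b)\<close> the inner product of two rows
  is the real part of one sum of powers of a root of unity plus the imaginary part of another; the
  imaginary part vanishes in either case, since the sum is \<open>n\<close> or 0.\<close>

lemma hartley_orthogonal:
  assumes "i < n" "l < n"
  shows "(\<Sum>j<n. hartley n i j * hartley n l j) = (if i = l then real n else 0)"
proof -
  have n: "n \<ge> 1" using assms by simp
  have cas: "(cos a + sin a) * (cos b + sin b) = cos (a - b) + sin (a + b)" for a b :: real
    by (simp add: cos_diff sin_add algebra_simps)
  let ?c = "\<lambda>m. \<Sum>k<n. cis (2 * pi * real_of_int m * real k / real n)"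
  have "(\<Sum>j<n. hartley n i j * hartley n l j)
     = Re (?c (int i - int l)) + Im (?c (int i + int l))"
    unfolding hartley_def cas Re_sum Im_sum by (simp add: sum.distrib algebra_simps diff_divide_distrib add_divide_distrib)
  moreover have "int n dvd int i - int l \<longleftrightarrow> i = l"
    using assms by (auto simp: mod_eq_dvd_iff[symmetric])
  ultimately show ?thesis
    unfolding sum_cis_root_unity[OF n] by simp
qed

lemma hartley_parseval:
  "(\<Sum>j<n. (\<Sum>i<n. hartley n i j * z i)\<^sup>2) = real n * (\<Sum>i<n. (z i)\<^sup>2)"
proof -
  have "(\<Sum>j<n. (\<Sum>i<n. hartley n i j * z i)\<^sup>2)
      = (\<Sum>j<n. \<Sum>i<n. \<Sum>l<n. hartley n i j * z i * (hartley n l j * z l))"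
    by (simp add: power2_eq_square sum_product)
  also have "\<dots> = (\<Sum>i<n. \<Sum>l<n. \<Sum>j<n. hartley n i j * z i * (hartley n l j * z l))"
    by (subst sum.swap) (intro sum.cong refl sum.swap)
  also have "\<dots> = (\<Sum>i<n. \<Sum>l<n. z i * z l * (\<Sum>j<n. hartley n i j * hartley n l j))"
    by (simp add: sum_distrib_left mult_ac)
  also have "\<dots> = (\<Sum>i<n. \<Sum>l<n. z i * z l * (if i = l then real n else 0))"
    by (intro sum.cong refl) (simp add: hartley_orthogonal)
  also have "\<dots> = (\<Sum>i<n. z i * z i * real n)"
    by (simp add: if_distrib cong: if_cong)
  finally show ?thesis by (simp add: power2_eq_square sum_distrib_left mult_ac)
qed

section \<open>Bilinear forms with flat orthogonal matrices on the unit ball of \<open>\<ell>\<^sub>p\<close>\<close>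

text \<open>A geometric series over dyadic scales is dominated by its largest term. The index set is a
  finite set of integers, as the scales that occur below may be negative.\<close>

lemma sum_dyadic_powr_le:
  fixes K :: "int set" and a z :: real
  assumes "finite K" "0 < a" "0 < z"
  shows "(\<Sum>k\<in>{k \<in> K. 2 powr k \<le> z}. 2 powr (a * k)) \<le> z powr a / (1 - 2 powr (- a))"
proof -
  define m where "m = \<lfloor>log 2 z\<rfloor>"
  define q :: real where "q = 2 powr (- a)"
  define L where "L = {k \<in> K. 2 powr k \<le> z}"
  have L: "finite L" "\<And>k. k \<in> L \<Longrightarrow> k \<le> m"
    using assms by (auto simp: L_def m_def le_floor_iff le_log_iff)
  have q: "0 < q" "q < 1"
    using assms powr_less_mono[of "-a" 0 "2::real"] by (auto simp: q_def)
  have "(\<Sum>k\<in>L. 2 powr (a * k)) = (\<Sum>k\<in>L. 2 powr (a * m) * q ^ nat (m - k))"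
  proof (intro sum.cong refl)
    fix k assume "k \<in> L"
    with L(2) have "real (nat (m - k)) = m - k" by simp
    then have "q ^ nat (m - k) = 2 powr (- a * (m - k))"
      by (simp add: q_def powr_powr flip: powr_realpow)
    then show "2 powr (a * k) = 2 powr (a * m) * q ^ nat (m - k)"
      by (simp add: powr_add[symmetric] algebra_simps)
  qed
  also have "\<dots> = 2 powr (a * m) * (\<Sum>i\<in>(\<lambda>k. nat (m - k)) ` L. q ^ i)"
    using L(2) by (subst sum.reindex) (auto simp: inj_on_def sum_distrib_left nat_eq_iff)
  also have "\<dots> \<le> 2 powr (a * m) * (1 / (1 - q))"
    using q L(1) sum_le_suminf[of "\<lambda>i. q ^ i" "(\<lambda>k. nat (m - k)) ` L"]
    by (intro mult_left_mono) (auto simp: summable_geometric suminf_geometric)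
  also have "2 powr (a * m) \<le> z powr a"
  proof -
    have "2 powr m \<le> z"
      using assms by (simp add: m_def powr_le_iff)
    then have "(2 powr m) powr a \<le> z powr a"
      using assms by (intro powr_mono2) auto
    then show ?thesis by (simp add: powr_powr mult.commute)
  qed
  finally show ?thesis
    using q by (simp add: L_def q_def mult_right_mono divide_right_mono)
qed

text \<open>A discrete Hausdorff--Young inequality: a matrix with entries bounded by \<open>M\<close> and operator norm
  at most \<open>sqrt n\<close> on \<open>\<ell>\<^sub>2\<close> maps \<open>\<ell>\<^sub>p\<close> to its dual with norm of order \<open>n powr (1 - 1 / p)\<close>. The proof
  is real interpolation between \<open>\<ell>\<^sub>1\<close> and \<open>\<ell>\<^sub>2\<close> in a form that includes \<open>p = 1\<close>. Group the
  coordinates of \<open>y\<close> by the dyadic scale \<open>2 powr k\<close> of \<open>\<bar>y j\<bar>\<close>, and against scale \<open>k\<close> split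
  \<open>x\<close> at height \<open>\<tau> / 2 powr k\<close>. The pairs with large \<open>\<bar>x i\<bar> \<bar>y j\<bar>\<close> are controlled by the entry
  bound, because \<open>z \<le> \<tau> powr (1 - p) z powr p\<close> for \<open>z > \<tau>\<close>. For the other pairs the
  \<open>\<ell>\<^sub>2\<close> bound applies scale by scale to the truncated vectors; weights \<open>2 powr ((p - 2) k)\<close> in the
  arithmetic-geometric mean inequality turn both resulting sums into \<open>p\<close>-th power sums, the one in \<open>x\<close>
  through the dyadic geometric series, which converges because \<open>p < 2\<close>.\<close>

lemma bilinear_form_bound:
  fixes h :: "nat \<Rightarrow> nat \<Rightarrow> real"
  assumes p: "1 \<le> p" "p < 2" and n: "n \<ge> 1"
    and M: "\<And>i j. \<bar>h i j\<bar> \<le> M"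
    and bessel: "\<And>z. (\<Sum>j<n. (\<Sum>i<n. h i j * z i)\<^sup>2) \<le> real n * (\<Sum>i<n. (z i)\<^sup>2)"
    and x: "(\<Sum>i<n. \<bar>x i\<bar> powr p) \<le> 1" and y: "(\<Sum>j<n. \<bar>y j\<bar> powr p) \<le> 1"
  shows "\<bar>\<Sum>i<n. \<Sum>j<n. h i j * x i * y j\<bar>
    \<le> (M + 1 + 1 / (2 * (1 - 2 powr (p - 2)))) * real n powr (1 - 1 / p)"
proof -
  \<comment> \<open>The threshold that balances the two contributions: both become multiples of \<open>D\<close>.\<close>
  define \<tau> where "\<tau> = real n powr (- (1 / p))"
  define D where "D = real n powr (1 - 1 / p)"
  define G where "G = 1 / (1 - 2 powr (p - 2))"
  define J where "J = {j. j < n \<and> y j \<noteq> 0}"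
  define \<kappa> where "\<kappa> j = \<lfloor>log 2 \<bar>y j\<bar>\<rfloor>" for j
  \<comment> \<open>The truncation of \<open>x\<close> that is used against the coordinates of \<open>y\<close> at scale \<open>k\<close>, and its
    image under the transposed matrix.\<close>
  define cut where "cut k i = (if \<bar>x i\<bar> * 2 powr real_of_int k \<le> \<tau> then x i else 0)" for k i
  define v where "v k j = (\<Sum>i<n. h i j * cut k i)" for k j
  have \<tau>: "\<tau> > 0" and D: "D > 0" using n by (auto simp: \<tau>_def D_def)
  have M0: "M \<ge> 0" using M[of 0 0] by linarith
  have J: "finite J" "J \<subseteq> {..<n}" by (auto simp: J_def)
  have \<kappa>: "2 powr \<kappa> j \<le> \<bar>y j\<bar>" "\<bar>y j\<bar> < 2 * 2 powr \<kappa> j" if "j \<in> J" for j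
  proof -
    have y0: "\<bar>y j\<bar> > 0" using that by (auto simp: J_def)
    show "2 powr \<kappa> j \<le> \<bar>y j\<bar>"
      using y0 by (simp add: \<kappa>_def powr_le_iff)
    have "log 2 \<bar>y j\<bar> < \<kappa> j + 1" by (simp add: \<kappa>_def)
    then have "\<bar>y j\<bar> < 2 powr (\<kappa> j + 1)" using y0 by (subst (asm) log_less_iff) auto
    then show "\<bar>y j\<bar> < 2 * 2 powr \<kappa> j" by (simp add: powr_add)
  qed

  have large: "(\<Sum>j\<in>J. \<Sum>i<n. \<bar>h i j * (x i - cut (\<kappa> j) i) * y j\<bar>) \<le> M * D"
  proof -
    have "\<bar>h i j * (x i - cut (\<kappa> j) i) * y j\<bar> \<le> M * \<tau> powr (1 - p) * (\<bar>x i\<bar> powr p * \<bar>y j\<bar> powr p)"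
      if j: "j \<in> J" for i j
    proof (cases "\<bar>x i\<bar> * 2 powr \<kappa> j \<le> \<tau>")
      case True
      then show ?thesis using M0 by (simp add: cut_def)
    next
      case False
      define t where "t = \<bar>x i\<bar> * \<bar>y j\<bar>"
      have "\<bar>x i\<bar> * 2 powr \<kappa> j \<le> t"
        unfolding t_def using \<kappa>(1)[OF j] by (intro mult_left_mono) auto
      then have t: "t > \<tau>" using False by simp
      have "\<bar>h i j * (x i - cut (\<kappa> j) i) * y j\<bar> = \<bar>h i j\<bar> * t"
        using False by (simp add: cut_def t_def abs_mult)
      also have "\<dots> \<le> M * t"
        using M \<tau> t by (intro mult_right_mono) auto
      also have "t = t powr (1 - p) * t powr p"
        using t \<tau> by (simp flip: powr_add)
      also have "t powr (1 - p) \<le> \<tau> powr (1 - p)"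
        using t \<tau> p by (intro powr_mono2') auto
      finally show ?thesis
        using M0 by (simp add: t_def powr_mult mult_left_mono mult_right_mono mult.assoc)
    qed
    then have "(\<Sum>j\<in>J. \<Sum>i<n. \<bar>h i j * (x i - cut (\<kappa> j) i) * y j\<bar>)
        \<le> (\<Sum>j\<in>J. \<Sum>i<n. M * \<tau> powr (1 - p) * (\<bar>x i\<bar> powr p * \<bar>y j\<bar> powr p))"
      by (intro sum_mono)
    also have "\<dots> = M * \<tau> powr (1 - p) * ((\<Sum>i<n. \<bar>x i\<bar> powr p) * (\<Sum>j\<in>J. \<bar>y j\<bar> powr p))"
      by (subst sum.swap) (simp add: sum_product sum_distrib_left mult_ac)
    also have "\<dots> \<le> M * \<tau> powr (1 - p) * (1 * 1)"
      using x M0 J by (intro mult_left_mono mult_mono order_trans[OF sum_mono2 y] sum_nonneg) auto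
    also have "\<tau> powr (1 - p) = D"
    proof -
      have "- (1 / p) * (1 - p) = 1 - 1 / p" using p by (simp add: field_simps)
      then show ?thesis by (simp only: \<tau>_def D_def powr_powr)
    qed
    finally show ?thesis by simp
  qed

  have small_y: "(\<Sum>j\<in>J. 2 powr ((p - 2) * \<kappa> j) * (y j)\<^sup>2) \<le> 2"
  proof -
    have "2 powr ((p - 2) * \<kappa> j) * (y j)\<^sup>2 \<le> 2 * \<bar>y j\<bar> powr p" if j: "j \<in> J" for j
    proof -
      have y0: "\<bar>y j\<bar> > 0" using j by (auto simp: J_def)
      have "2 powr ((p - 2) * \<kappa> j) = (2 powr \<kappa> j) powr (p - 2)"
        by (simp add: powr_powr mult.commute)
      also have "\<dots> \<le> (\<bar>y j\<bar> / 2) powr (p - 2)"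
        using \<kappa>(2)[OF j] y0 p by (intro powr_mono2') auto
      also have "\<dots> = 2 powr (2 - p) * \<bar>y j\<bar> powr (p - 2)"
        using powr_minus[of 2 "p - 2"] by (simp add: powr_divide field_simps)
      also have "\<dots> \<le> 2 powr 1 * \<bar>y j\<bar> powr (p - 2)"
        using p by (intro mult_right_mono powr_mono) auto
      finally have "2 powr ((p - 2) * \<kappa> j) * (y j)\<^sup>2 \<le> 2 * \<bar>y j\<bar> powr (p - 2) * \<bar>y j\<bar> powr 2"
        using y0 by (simp add: mult_right_mono)
      then show ?thesis
        by (simp add: mult.assoc powr_add[symmetric] del: powr_numeral)
    qed
    then have "(\<Sum>j\<in>J. 2 powr ((p - 2) * \<kappa> j) * (y j)\<^sup>2) \<le> (\<Sum>j\<in>J. 2 * \<bar>y j\<bar> powr p)"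
      by (intro sum_mono)
    also have "\<dots> \<le> 2 * 1"
      unfolding sum_distrib_left[symmetric] using J
      by (intro mult_left_mono order_trans[OF sum_mono2 y]) auto
    finally show ?thesis by simp
  qed

  have small_v: "(\<Sum>j\<in>J. 2 powr ((2 - p) * \<kappa> j) * (v (\<kappa> j) j)\<^sup>2) \<le> G * D\<^sup>2"
  proof -
    let ?K = "\<kappa> ` J"
    have G: "G > 0" unfolding G_def using p powr_less_mono[of "p-2" 0 "2::real"] by simp
    \<comment> \<open>Within one scale the vector \<open>v k\<close> is fixed, so extending the sum to all coordinates allows
      the \<open>\<ell>\<^sub>2\<close> bound; the sum over scales is then carried out for each coordinate of \<open>x\<close>.\<close>
    have "(\<Sum>j\<in>J. 2 powr ((2 - p) * \<kappa> j) * (v (\<kappa> j) j)\<^sup>2)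
        = (\<Sum>k\<in>?K. \<Sum>j\<in>{j \<in> J. \<kappa> j = k}. 2 powr ((2 - p) * \<kappa> j) * (v (\<kappa> j) j)\<^sup>2)"
      using J by (intro sum.image_gen)
    also have "\<dots> = (\<Sum>k\<in>?K. \<Sum>j\<in>{j \<in> J. \<kappa> j = k}. 2 powr ((2 - p) * k) * (v k j)\<^sup>2)"
      by (intro sum.cong) auto
    also have "\<dots> \<le> (\<Sum>k\<in>?K. \<Sum>j<n. 2 powr ((2 - p) * k) * (v k j)\<^sup>2)"
      using J by (intro sum_mono sum_mono2) auto
    also have "\<dots> \<le> (\<Sum>k\<in>?K. 2 powr ((2 - p) * k) * (real n * (\<Sum>i<n. (cut k i)\<^sup>2)))"
      unfolding sum_distrib_left[symmetric] v_def
      by (intro sum_mono mult_left_mono bessel) auto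
    also have "\<dots> = real n * (\<Sum>i<n. \<Sum>k\<in>?K. 2 powr ((2 - p) * k) * (cut k i)\<^sup>2)"
      by (subst sum.swap) (simp add: sum_distrib_left mult_ac)
    also have "\<dots> \<le> real n * (\<Sum>i<n. G * \<tau> powr (2 - p) * \<bar>x i\<bar> powr p)"
    proof (intro mult_left_mono sum_mono)
      fix i
      show "(\<Sum>k\<in>?K. 2 powr ((2 - p) * k) * (cut k i)\<^sup>2) \<le> G * \<tau> powr (2 - p) * \<bar>x i\<bar> powr p"
      proof (cases "x i = 0")
        case True
        then show ?thesis by (simp add: cut_def)
      next
        case False
        have "(\<Sum>k\<in>?K. 2 powr ((2 - p) * k) * (cut k i)\<^sup>2)
            = (\<Sum>k\<in>?K. if 2 powr k \<le> \<tau> / \<bar>x i\<bar> then 2 powr ((2 - p) * k) * (x i)\<^sup>2 else 0)"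
          using False by (intro sum.cong) (auto simp: cut_def field_simps)
        also have "\<dots> = (\<Sum>k\<in>{k \<in> ?K. 2 powr k \<le> \<tau> / \<bar>x i\<bar>}. 2 powr ((2 - p) * k)) * (x i)\<^sup>2"
          using J by (simp add: sum.inter_filter[symmetric] sum_distrib_right)
        also have "\<dots> \<le> ((\<tau> / \<bar>x i\<bar>) powr (2 - p) / (1 - 2 powr (- (2 - p)))) * (x i)\<^sup>2"
          using J False p \<tau> sum_dyadic_powr_le[of ?K "2 - p" "\<tau> / \<bar>x i\<bar>"]
          by (intro mult_right_mono) simp_all
        also have "(\<tau> / \<bar>x i\<bar>) powr (2 - p) * (x i)\<^sup>2 = \<tau> powr (2 - p) * \<bar>x i\<bar> powr p"
        proof -
          have "(x i)\<^sup>2 = \<bar>x i\<bar> powr (2 - p) * \<bar>x i\<bar> powr p"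
            using False by (simp flip: powr_add)
          then show ?thesis using False \<tau> by (simp add: powr_divide)
        qed
        then have "((\<tau> / \<bar>x i\<bar>) powr (2 - p) / (1 - 2 powr (- (2 - p)))) * (x i)\<^sup>2
            = G * \<tau> powr (2 - p) * \<bar>x i\<bar> powr p"
          by (simp add: G_def)
        finally show ?thesis .
      qed
    qed simp
    also have "\<dots> = real n * (G * \<tau> powr (2 - p)) * (\<Sum>i<n. \<bar>x i\<bar> powr p)"
      by (simp add: sum_distrib_left mult_ac)
    also have "\<dots> \<le> real n * (G * \<tau> powr (2 - p)) * 1"
      using x G by (intro mult_left_mono) auto
    also have "real n * \<tau> powr (2 - p) = D\<^sup>2"
    proof -
      have "real n * \<tau> powr (2 - p) = real n powr (1 + (- (1 / p)) * (2 - p))"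
        unfolding \<tau>_def powr_powr powr_add using n by simp
      also have "1 + (- (1 / p)) * (2 - p) = (1 - 1 / p) * 2"
        using p by (simp add: field_simps)
      finally show ?thesis
        unfolding powr_powr[symmetric] D_def[symmetric] using D by simp
    qed
    then have "real n * (G * \<tau> powr (2 - p)) * 1 = G * D\<^sup>2" by (simp add: mult_ac)
    finally show ?thesis .
  qed

  have small: "(\<Sum>j\<in>J. \<bar>y j * v (\<kappa> j) j\<bar>) \<le> D + G * D / 2"
  proof -
    have "\<bar>y j * v (\<kappa> j) j\<bar> \<le> D / 2 * (2 powr ((p - 2) * \<kappa> j) * (y j)\<^sup>2)
        + 1 / (2 * D) * (2 powr ((2 - p) * \<kappa> j) * (v (\<kappa> j) j)\<^sup>2)" for j
    proof -
      define w where "w = sqrt (D * 2 powr ((p - 2) * \<kappa> j))"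
      have w: "w > 0" "w\<^sup>2 = D * 2 powr ((p - 2) * \<kappa> j)"
        using D by (auto simp: w_def)
      have "0 \<le> (w * \<bar>y j\<bar> - \<bar>v (\<kappa> j) j\<bar> / w)\<^sup>2" by simp
      also have "\<dots> = w\<^sup>2 * (y j)\<^sup>2 + (v (\<kappa> j) j)\<^sup>2 / w\<^sup>2 - 2 * \<bar>y j * v (\<kappa> j) j\<bar>"
        using w(1) by (simp add: power2_diff power_mult_distrib power_divide abs_mult)
      finally have le: "2 * \<bar>y j * v (\<kappa> j) j\<bar> \<le> w\<^sup>2 * (y j)\<^sup>2 + (v (\<kappa> j) j)\<^sup>2 / w\<^sup>2" by simp
      have "2 powr ((2 - p) * \<kappa> j) = 1 / 2 powr ((p - 2) * \<kappa> j)"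
        by (simp add: powr_minus_divide[symmetric] algebra_simps)
      then have eq: "D / 2 * (2 powr ((p - 2) * \<kappa> j) * (y j)\<^sup>2)
          + 1 / (2 * D) * (2 powr ((2 - p) * \<kappa> j) * (v (\<kappa> j) j)\<^sup>2)
        = (w\<^sup>2 * (y j)\<^sup>2 + (v (\<kappa> j) j)\<^sup>2 / w\<^sup>2) / 2"
        by (simp only: w(2)) (simp add: add_divide_distrib)
      show ?thesis
        unfolding eq using le by simp
    qed
    then have "(\<Sum>j\<in>J. \<bar>y j * v (\<kappa> j) j\<bar>)
        \<le> (\<Sum>j\<in>J. D / 2 * (2 powr ((p - 2) * \<kappa> j) * (y j)\<^sup>2)
          + 1 / (2 * D) * (2 powr ((2 - p) * \<kappa> j) * (v (\<kappa> j) j)\<^sup>2))"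
      by (intro sum_mono)
    also have "\<dots> = D / 2 * (\<Sum>j\<in>J. 2 powr ((p - 2) * \<kappa> j) * (y j)\<^sup>2)
          + 1 / (2 * D) * (\<Sum>j\<in>J. 2 powr ((2 - p) * \<kappa> j) * (v (\<kappa> j) j)\<^sup>2)"
      by (simp only: sum.distrib sum_distrib_left)
    also have "\<dots> \<le> D / 2 * 2 + 1 / (2 * D) * (G * D\<^sup>2)"
      using D by (intro add_mono mult_left_mono small_y small_v) auto
    finally show ?thesis using D by (simp add: power2_eq_square)
  qed

  have "(\<Sum>i<n. \<Sum>j<n. h i j * x i * y j) = (\<Sum>j<n. \<Sum>i<n. h i j * x i * y j)"
    by (rule sum.swap)
  also have "\<dots> = (\<Sum>j\<in>J. \<Sum>i<n. h i j * x i * y j)"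
    by (intro sum.mono_neutral_right) (auto simp: J_def)
  also have "\<dots> = (\<Sum>j\<in>J. (\<Sum>i<n. h i j * (x i - cut (\<kappa> j) i) * y j) + y j * v (\<kappa> j) j)"
    unfolding v_def sum_distrib_left sum.distrib[symmetric]
    by (intro sum.cong refl) (simp add: algebra_simps)
  finally have "\<bar>\<Sum>i<n. \<Sum>j<n. h i j * x i * y j\<bar>
      \<le> (\<Sum>j\<in>J. \<bar>(\<Sum>i<n. h i j * (x i - cut (\<kappa> j) i) * y j) + y j * v (\<kappa> j) j\<bar>)"
    by (simp add: sum_abs)
  also have "\<dots> \<le> (\<Sum>j\<in>J. (\<Sum>i<n. \<bar>h i j * (x i - cut (\<kappa> j) i) * y j\<bar>) + \<bar>y j * v (\<kappa> j) j\<bar>)"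
    by (intro sum_mono order_trans[OF abs_triangle_ineq] add_mono sum_abs order_refl)
  also have "\<dots> \<le> M * D + (D + G * D / 2)"
    unfolding sum.distrib by (intro add_mono large small)
  finally show ?thesis by (simp add: D_def G_def algebra_simps)
qed

section \<open>Duality for homogeneous norms\<close>

text \<open>Absolute homogeneity is what lets the supremum over the unit ball that defines the dual norm
  control a functional on the entire space; for \<open>\<ell>\<^sub>p\<close> it is immediate from the formula.\<close>

definition homogeneous_norm :: "'a::real_vector nspace \<Rightarrow> bool" where
  "homogeneous_norm E \<longleftrightarrow> 0 \<in> vecs E \<and>
    (\<forall>x\<in>vecs E. 0 \<le> nrm E x \<and> (\<forall>r. r *\<^sub>R x \<in> vecs E \<and> nrm E (r *\<^sub>R x) = \<bar>r\<bar> * nrm E x))"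

lemma homogeneous_norm_nonneg: "homogeneous_norm E \<Longrightarrow> x \<in> vecs E \<Longrightarrow> 0 \<le> nrm E x"
  by (simp add: homogeneous_norm_def)

lemma homogeneous_norm_scale:
  assumes "homogeneous_norm E" "x \<in> vecs E"
  shows "r *\<^sub>R x \<in> vecs E" "nrm E (r *\<^sub>R x) = \<bar>r\<bar> * nrm E x"
  using assms by (auto simp: homogeneous_norm_def)

lemma homogeneous_norm_zero:
  assumes "homogeneous_norm E"
  shows "0 \<in> vecs E" "nrm E 0 = 0"
  using assms homogeneous_norm_scale(2)[OF assms, of 0 0] by (auto simp: homogeneous_norm_def)

lemma linear_on_scale: "linear_on S f \<Longrightarrow> x \<in> S \<Longrightarrow> f (r *\<^sub>R x) = r *\<^sub>R f x"
  by (simp add: linear_on_def)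

lemma linear_on_add: "linear_on S f \<Longrightarrow> x \<in> S \<Longrightarrow> y \<in> S \<Longrightarrow> f (x + y) = f x + f y"
  by (simp add: linear_on_def)

lemma dual_ball_bdd_above:
  assumes "homogeneous_norm E" "f \<in> vecs (dual_space E)"
  shows "bdd_above ((\<lambda>x. \<bar>f x\<bar>) ` {x \<in> vecs E. nrm E x \<le> 1})"
proof -
  obtain K where K: "\<And>x. x \<in> vecs E \<Longrightarrow> \<bar>f x\<bar> \<le> K * nrm E x"
    using assms(2) by (auto simp: dual_space_def)
  have "\<bar>f x\<bar> \<le> \<bar>K\<bar>" if "x \<in> vecs E" "nrm E x \<le> 1" for x
  proof -
    have "K * nrm E x \<le> \<bar>K\<bar> * 1"
      using that homogeneous_norm_nonneg[OF assms(1)] by (intro mult_mono) auto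
    with K[OF that(1)] show ?thesis by simp
  qed
  then show ?thesis by (auto intro!: bdd_aboveI[of _ "\<bar>K\<bar>"])
qed

lemma dual_norm_le:
  assumes "homogeneous_norm E" "\<And>x. x \<in> vecs E \<Longrightarrow> nrm E x \<le> 1 \<Longrightarrow> \<bar>f x\<bar> \<le> t"
  shows "nrm (dual_space E) f \<le> t"
  using assms homogeneous_norm_zero[OF assms(1)]
  by (auto simp: dual_space_def intro!: cSUP_least)

lemma dual_norm_nonneg:
  assumes "homogeneous_norm E" "f \<in> vecs (dual_space E)"
  shows "0 \<le> nrm (dual_space E) f"
  using homogeneous_norm_zero[OF assms(1)]
    cSUP_upper[OF _ dual_ball_bdd_above[OF assms], of 0] by (simp add: dual_space_def)

text \<open>Rescaling to the unit sphere. A vector of norm 0 is handled by the boundedness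
  condition in the definition of the dual space, which forces \<open>f x = 0\<close>.\<close>

lemma dual_norm_bound:
  assumes E: "homogeneous_norm E" and f: "f \<in> vecs (dual_space E)" and x: "x \<in> vecs E"
  shows "\<bar>f x\<bar> \<le> nrm (dual_space E) f * nrm E x"
proof (cases "nrm E x = 0")
  case True
  then show ?thesis using f x by (auto simp: dual_space_def)
next
  case False
  then have pos: "nrm E x > 0" using homogeneous_norm_nonneg[OF E x] by simp
  let ?x = "(1 / nrm E x) *\<^sub>R x"
  have "?x \<in> vecs E" "nrm E ?x = 1"
    using homogeneous_norm_scale[OF E x] pos by auto
  then have "\<bar>f ?x\<bar> \<le> nrm (dual_space E) f"
    using cSUP_upper[OF _ dual_ball_bdd_above[OF E f], of ?x] by (simp add: dual_space_def)
  moreover have "f ?x = f x / nrm E x"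
    using f x linear_on_scale[of "vecs E" f x "1 / nrm E x"] by (auto simp: dual_space_def)
  ultimately show ?thesis using pos by (simp add: field_simps)
qed

text \<open>To cover vectors of norm 0 as well, the rescaling uses \<open>nrm E x + e\<close> instead of \<open>nrm E x\<close>.\<close>

lemma op_norm_le_oneD:
  assumes E: "homogeneous_norm E" and A: "A \<in> linear_maps E (dual_space E)"
    and op: "op_norm E (dual_space E) A \<le> 1" and x: "x \<in> vecs E"
  shows "nrm (dual_space E) (A x) \<le> nrm E x"
proof -
  have ball: "nrm (dual_space E) (A z) \<le> 1" if "z \<in> vecs E" "nrm E z \<le> 1" for z
  proof -
    have "ennreal (nrm (dual_space E) (A z)) \<le> op_norm E (dual_space E) A"
      unfolding op_norm_def using that by (intro SUP_upper) auto
    from order_trans[OF this op] show ?thesis by simp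
  qed
  show ?thesis
  proof (rule field_le_epsilon)
    fix e :: real assume e: "e > 0"
    define t where "t = nrm E x + e"
    have t: "t > 0" using homogeneous_norm_nonneg[OF E x] e by (simp add: t_def)
    let ?z = "(1 / t) *\<^sub>R x"
    have z: "?z \<in> vecs E" "nrm E ?z \<le> 1"
      using homogeneous_norm_scale[OF E x] t e by (auto simp: t_def)
    have Az: "A ?z \<in> vecs (dual_space E)" and AzE: "A ?z = (1 / t) *\<^sub>R A x"
      using A z x by (auto simp: linear_maps_def linear_on_scale)
    show "nrm (dual_space E) (A x) \<le> nrm E x + e"
    proof (rule dual_norm_le[OF E])
      fix y assume y: "y \<in> vecs E" "nrm E y \<le> 1"
      have "\<bar>A ?z y\<bar> \<le> nrm (dual_space E) (A ?z) * nrm E y"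
        by (rule dual_norm_bound[OF E Az y(1)])
      also have "\<dots> \<le> 1 * 1"
        using y ball[OF z] homogeneous_norm_nonneg[OF E] by (intro mult_mono) auto
      finally show "\<bar>A x y\<bar> \<le> nrm E x + e"
        using t unfolding AzE t_def[symmetric] by (simp add: abs_mult field_simps)
    qed
  qed
qed

lemma zero_in_dual_space:
  assumes "homogeneous_norm E"
  shows "(\<lambda>_. 0) \<in> vecs (dual_space E)" "nrm (dual_space E) (\<lambda>_. 0) \<le> 0"
  using dual_norm_le[OF assms, of "\<lambda>_. 0" 0]
  by (auto simp: dual_space_def linear_on_def intro!: exI[of _ 0])

lemma bilinear_dual_pairing: "bilinear_on (vecs (dual_space E)) (vecs E) (\<lambda>f x. f x)"
  by (auto simp: bilinear_on_def linear_on_def dual_space_def)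

lemma bilinear_on_functional_product:
  assumes "linear_on S \<phi>" "linear_on T \<psi>"
  shows "bilinear_on S T (\<lambda>x y. \<phi> x * \<psi> y)"
  using assms by (auto simp: bilinear_on_def linear_on_def algebra_simps)

section \<open>Bounds for the projective norm\<close>

lemma sum_fun_apply: "(\<Sum>i\<in>I. f i) x = (\<Sum>i\<in>I. f i x :: 'b::real_vector)"
  by (induction I rule: infinite_finite_induct) simp_all

lemma proj_norm_le:
  assumes E: "\<And>x. x \<in> vecs E \<Longrightarrow> 0 \<le> nrm E x" and F: "\<And>y. y \<in> vecs F \<Longrightarrow> 0 \<le> nrm F y"
    and xy: "\<And>i. i < k \<Longrightarrow> x i \<in> vecs E" "\<And>i. i < k \<Longrightarrow> y i \<in> vecs F"
  shows "nrm (proj_tensor E F) (\<Sum>i<k. elem_tensor (vecs E) (vecs F) (x i) (y i))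
    \<le> (\<Sum>i<(k::nat). nrm E (x i) * nrm F (y i))"
  unfolding proj_tensor_def nspace.simps
proof (rule cInf_lower)
  show "(\<Sum>i<k. nrm E (x i) * nrm F (y i))
    \<in> {(\<Sum>i<k'. nrm E (x' i) * nrm F (y' i)) | (k'::nat) x' y'.
        (\<forall>i<k'. x' i \<in> vecs E \<and> y' i \<in> vecs F) \<and>
        (\<Sum>i<k. elem_tensor (vecs E) (vecs F) (x i) (y i))
          = (\<Sum>i<k'. elem_tensor (vecs E) (vecs F) (x' i) (y' i))}"
    using xy by (intro CollectI exI[of _ k] exI[of _ x] exI[of _ y]) simp
qed (auto intro!: bdd_belowI[of _ 0] sum_nonneg mult_nonneg_nonneg E F)

text \<open>Easy half of the duality between the projective norm and bilinear forms of norm at most 1.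
  The representation of \<open>w\<close> ensures that the infimum ranges over a nonempty set.\<close>

lemma proj_norm_ge:
  assumes xy: "\<And>i. i < k \<Longrightarrow> x i \<in> vecs E" "\<And>i. i < k \<Longrightarrow> y i \<in> vecs F"
    and w: "w = (\<Sum>i<(k::nat). elem_tensor (vecs E) (vecs F) (x i) (y i))"
    and B: "bilinear_on (vecs E) (vecs F) B"
    and B_le: "\<And>x y. x \<in> vecs E \<Longrightarrow> y \<in> vecs F \<Longrightarrow> B x y \<le> nrm E x * nrm F y"
  shows "w B \<le> nrm (proj_tensor E F) w"
proof -
  let ?R = "{(\<Sum>i<k. nrm E (x i) * nrm F (y i)) | (k::nat) x y.
                   (\<forall>i<k. x i \<in> vecs E \<and> y i \<in> vecs F) \<and>
                   w = (\<Sum>i<k. elem_tensor (vecs E) (vecs F) (x i) (y i))}"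
  have "w B \<le> Inf ?R"
  proof (rule cInf_greatest)
    show "?R \<noteq> {}"
      unfolding ex_in_conv[symmetric] using xy w
      by (intro exI[of _ "\<Sum>i<k. nrm E (x i) * nrm F (y i)"] CollectI
          exI[of _ k] exI[of _ x] exI[of _ y]) simp
    fix r assume "r \<in> ?R"
    then obtain k' x' y' where r: "r = (\<Sum>i<(k'::nat). nrm E (x' i) * nrm F (y' i))"
      and xy': "\<forall>i<k'. x' i \<in> vecs E \<and> y' i \<in> vecs F"
      and w': "w = (\<Sum>i<k'. elem_tensor (vecs E) (vecs F) (x' i) (y' i))"
      by blast
    have "w B = (\<Sum>i<k'. B (x' i) (y' i))"
      using B by (simp add: w' sum_fun_apply elem_tensor_def)
    also have "\<dots> \<le> r"
      unfolding r using xy' by (intro sum_mono B_le) auto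
    finally show "w B \<le> r" .
  qed
  then show ?thesis by (simp add: proj_tensor_def)
qed

section \<open>Coordinates in \<open>\<ell>\<^sub>p\<close> and in its tensor products\<close>

definition unit_vec :: "nat \<Rightarrow> nat \<Rightarrow> real" where
  "unit_vec i = (\<lambda>k. if k = i then 1 else 0)"

lemma vecs_lp [simp]: "x \<in> vecs (lp_space p n) \<longleftrightarrow> (\<forall>i\<ge>n. x i = 0)"
  by (simp add: lp_space_def)

lemma nrm_lp: "nrm (lp_space p n) x = (\<Sum>i<n. \<bar>x i\<bar> powr p) powr (1 / p)"
  by (simp add: lp_space_def)

lemma homogeneous_lp:
  assumes "p \<ge> 1"
  shows "homogeneous_norm (lp_space p n)"
  using assms by (auto simp: homogeneous_norm_def nrm_lp abs_mult powr_mult powr_powr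
      sum_distrib_left[symmetric] sum_nonneg)

lemma unit_vec_lp:
  assumes "p \<ge> 1" "j < n"
  shows "unit_vec j \<in> vecs (lp_space p n)" "nrm (lp_space p n) (unit_vec j) = 1"
proof -
  have "(\<Sum>i<n. \<bar>unit_vec j i\<bar> powr p) = (\<Sum>i<n. if i = j then 1 else 0)"
    by (intro sum.cong) (auto simp: unit_vec_def)
  then show "nrm (lp_space p n) (unit_vec j) = 1"
    using assms by (simp add: nrm_lp)
qed (use assms in \<open>auto simp: unit_vec_def\<close>)

lemma coord_le_lp_norm:
  assumes "p \<ge> 1" "j < n"
  shows "\<bar>x j\<bar> \<le> nrm (lp_space p n) x"
proof -
  have "(\<bar>x j\<bar> powr p) powr (1 / p) \<le> nrm (lp_space p n) x"
    unfolding nrm_lp using assms by (intro powr_mono2 member_le_sum) auto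
  then show ?thesis using assms by (simp add: powr_powr)
qed

lemma lp_norm_le_oneD:
  assumes "p \<ge> 1" "nrm (lp_space p n) x \<le> 1"
  shows "(\<Sum>i<n. \<bar>x i\<bar> powr p) \<le> 1"
proof -
  have "nrm (lp_space p n) x powr p \<le> 1 powr p"
    using assms by (intro powr_mono2) (auto simp: nrm_lp)
  then show ?thesis using assms by (simp add: nrm_lp powr_powr sum_nonneg)
qed

lemma l1_le_lp:
  assumes "p \<ge> 1"
  shows "(\<Sum>i<n. \<bar>x i\<bar>) \<le> real n powr (1 - 1 / p) * nrm (lp_space p n) x"
  using power_mean_ineq[of "{..<n}" 1 p "\<lambda>i. \<bar>x i\<bar>"] assms by (simp add: nrm_lp sum_nonneg)

lemma lp_le_l2:
  assumes "p \<ge> 1" "p < 2"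
  shows "nrm (lp_space p n) x \<le> real n powr (1 / p - 1 / 2) * sqrt (\<Sum>i<n. (x i)\<^sup>2)"
  using power_mean_ineq[of "{..<n}" p 2 "\<lambda>i. \<bar>x i\<bar>"] assms
  by (simp add: nrm_lp powr_half_sqrt sum_nonneg)

lemma linear_on_lp_expand:
  assumes f: "linear_on (vecs (lp_space p n)) f" and x: "x \<in> vecs (lp_space p n)"
  shows "f x = (\<Sum>i<n. x i *\<^sub>R f (unit_vec i))"
proof -
  have "f (\<lambda>i. if i < m then x i else 0) = (\<Sum>i<m. x i *\<^sub>R f (unit_vec i))" if "m \<le> n" for m
    using that
  proof (induction m)
    case 0
    have "f (0 *\<^sub>R 0) = 0 *\<^sub>R f 0" by (rule linear_on_scale[OF f]) simp
    then show ?case by (simp add: zero_fun_def)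
  next
    case (Suc m)
    have "(\<lambda>i. if i < Suc m then x i else 0)
        = (\<lambda>i. if i < m then x i else 0) + x m *\<^sub>R unit_vec m"
      by (auto simp: fun_eq_iff unit_vec_def less_Suc_eq)
    moreover have "f (\<dots>) = f (\<lambda>i. if i < m then x i else 0) + f (x m *\<^sub>R unit_vec m)"
      using Suc.prems by (intro linear_on_add[OF f]) (auto simp: unit_vec_def)
    moreover have "f (x m *\<^sub>R unit_vec m) = x m *\<^sub>R f (unit_vec m)"
      using Suc.prems by (intro linear_on_scale[OF f]) (auto simp: unit_vec_def)
    ultimately show ?case using Suc by simp
  qed
  from this[of n] have "f (\<lambda>i. if i < n then x i else 0) = (\<Sum>i<n. x i *\<^sub>R f (unit_vec i))" by simp
  moreover have "(\<lambda>i. if i < n then x i else 0) = x" using x by (auto simp: fun_eq_iff)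
  ultimately show ?thesis by simp
qed

text \<open>A tensor is determined by its coefficient matrix, whose entries are its values on the products
  of coordinate functionals.\<close>

lemma lp_tensor_expand:
  assumes u: "u \<in> tensors (vecs (lp_space p n)) (vecs (lp_space q m))"
    and B: "bilinear_on (vecs (lp_space p n)) (vecs (lp_space q m)) B"
  shows "u B = (\<Sum>i<n. \<Sum>j<m. u (\<lambda>x y. x i * y j) * B (unit_vec i) (unit_vec j))"
proof -
  let ?V = "vecs (lp_space p n)" and ?W = "vecs (lp_space q m)"
  let ?P = "\<lambda>u. u B = (\<Sum>i<n. \<Sum>j<m. u (\<lambda>x y. x i * y j) * B (unit_vec i) (unit_vec j))"
  have "?P u"
    using u unfolding tensors_def
  proof (rule span_induct)
    show "subspace {u. ?P u}"
      by (auto simp: subspace_def sum.distrib sum_distrib_left algebra_simps)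
  next
    fix t assume "t \<in> {elem_tensor ?V ?W x y | x y. x \<in> ?V \<and> y \<in> ?W}"
    then obtain x y where t: "t = elem_tensor ?V ?W x y" and xy: "x \<in> ?V" "y \<in> ?W" by blast
    have coord: "bilinear_on ?V ?W (\<lambda>x y. x i * y j)" for i j
      by (rule bilinear_on_functional_product) (auto simp: linear_on_def)
    have "B x y = (\<Sum>i<n. x i * B (unit_vec i) y)"
      using linear_on_lp_expand[of p n "\<lambda>x. B x y" x] B xy by (auto simp: bilinear_on_def)
    also have "\<dots> = (\<Sum>i<n. x i * (\<Sum>j<m. y j * B (unit_vec i) (unit_vec j)))"
    proof (intro sum.cong refl)
      fix i assume "i \<in> {..<n}"
      then have "unit_vec i \<in> ?V" by (auto simp: unit_vec_def)
      then show "x i * B (unit_vec i) y = x i * (\<Sum>j<m. y j * B (unit_vec i) (unit_vec j))"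
        using linear_on_lp_expand[of q m "B (unit_vec i)" y] B xy by (auto simp: bilinear_on_def)
    qed
    finally show "?P t"
      using B coord by (simp add: t elem_tensor_def sum_distrib_left mult.assoc)
  qed
  then show ?thesis .
qed

text \<open>The supremum in the injective norm ranges over a bounded set, because functionals in the dual
  unit ball take values of modulus at most 1 on the unit vectors; the absolute sum of the coefficients is
  therefore a bound.\<close>

lemma inj_norm_ge:
  assumes p: "p \<ge> 1" "q \<ge> 1"
    and u: "u \<in> tensors (vecs (lp_space p n)) (vecs (lp_space q m))"
    and \<phi>: "\<phi> \<in> vecs (dual_space (lp_space p n))" "nrm (dual_space (lp_space p n)) \<phi> \<le> 1"
    and \<psi>: "\<psi> \<in> vecs (dual_space (lp_space q m))" "nrm (dual_space (lp_space q m)) \<psi> \<le> 1"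
  shows "\<bar>u (\<lambda>x y. \<phi> x * \<psi> y)\<bar> \<le> nrm (inj_tensor (lp_space p n) (lp_space q m)) u"
proof -
  let ?c = "\<lambda>i j. u (\<lambda>x y. x i * y j)"
  have coord: "\<bar>f (unit_vec i)\<bar> \<le> 1"
    if "f \<in> vecs (dual_space (lp_space r k))" "nrm (dual_space (lp_space r k)) f \<le> 1" "i < k" "r \<ge> 1"
    for f r k i
    using dual_norm_bound[OF homogeneous_lp[OF that(4)] that(1) unit_vec_lp(1)[OF that(4,3)]] that
    by (simp add: unit_vec_lp(2))
  have "bdd_above {\<bar>u (\<lambda>x y. \<phi> x * \<psi> y)\<bar> | \<phi> \<psi>.
      \<phi> \<in> vecs (dual_space (lp_space p n)) \<and> nrm (dual_space (lp_space p n)) \<phi> \<le> 1 \<and>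
      \<psi> \<in> vecs (dual_space (lp_space q m)) \<and> nrm (dual_space (lp_space q m)) \<psi> \<le> 1}"
  proof (rule bdd_aboveI[of _ "\<Sum>i<n. \<Sum>j<m. \<bar>?c i j\<bar>"], clarify)
    fix f g
    assume f: "f \<in> vecs (dual_space (lp_space p n))" "nrm (dual_space (lp_space p n)) f \<le> 1"
      and g: "g \<in> vecs (dual_space (lp_space q m))" "nrm (dual_space (lp_space q m)) g \<le> 1"
    have "bilinear_on (vecs (lp_space p n)) (vecs (lp_space q m)) (\<lambda>x y. f x * g y)"
      using f(1) g(1) by (intro bilinear_on_functional_product) (auto simp: dual_space_def)
    then have "\<bar>u (\<lambda>x y. f x * g y)\<bar>
        = \<bar>\<Sum>i<n. \<Sum>j<m. ?c i j * (f (unit_vec i) * g (unit_vec j))\<bar>"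
      by (subst lp_tensor_expand[OF u]) auto
    also have "\<dots> \<le> (\<Sum>i<n. \<Sum>j<m. \<bar>?c i j * (f (unit_vec i) * g (unit_vec j))\<bar>)"
      by (rule order_trans[OF sum_abs], intro sum_mono, rule sum_abs)
    also have "\<dots> \<le> (\<Sum>i<n. \<Sum>j<m. \<bar>?c i j\<bar> * (1 * 1))"
      unfolding abs_mult using coord[OF f] coord[OF g] p
      by (intro sum_mono mult_left_mono mult_mono) auto
    finally show "\<bar>u (\<lambda>x y. f x * g y)\<bar> \<le> (\<Sum>i<n. \<Sum>j<m. \<bar>?c i j\<bar>)" by simp
  qed
  then show ?thesis
    unfolding inj_tensor_def nspace.simps using \<phi> \<psi>
    by (intro cSup_upper CollectI exI[of _ \<phi>] exI[of _ \<psi>] conjI refl)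
qed

text \<open>The factor \<open>n powr (1 / p - 1)\<close> normalises a vector of signs in the dual of \<open>\<ell>\<^sub>p\<close>. Vectors outside
  the space are sent to 0, as membership in the dual space requires.\<close>

definition sign_functional :: "real \<Rightarrow> nat \<Rightarrow> (nat \<Rightarrow> real) \<Rightarrow> (nat \<Rightarrow> real) \<Rightarrow> real" where
  "sign_functional p n s = (\<lambda>x. if x \<in> vecs (lp_space p n)
     then real n powr (1 / p - 1) * (\<Sum>i<n. s i * x i) else 0)"

lemma sign_functional_dual:
  assumes p: "p \<ge> 1" and n: "n \<ge> 1" and s: "\<And>i. \<bar>s i\<bar> = 1"
  shows "sign_functional p n s \<in> vecs (dual_space (lp_space p n))"
    "nrm (dual_space (lp_space p n)) (sign_functional p n s) \<le> 1"
proof -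
  have le: "\<bar>sign_functional p n s x\<bar> \<le> 1 * nrm (lp_space p n) x" if "x \<in> vecs (lp_space p n)" for x
  proof -
    have "\<bar>sign_functional p n s x\<bar> = real n powr (1 / p - 1) * \<bar>\<Sum>i<n. s i * x i\<bar>"
      using that by (simp add: sign_functional_def abs_mult)
    also have "\<bar>\<Sum>i<n. s i * x i\<bar> \<le> (\<Sum>i<n. \<bar>x i\<bar>)"
      using s by (intro order_trans[OF sum_abs]) (simp add: abs_mult)
    also note l1_le_lp[OF p]
    also have "real n powr (1 / p - 1) * (real n powr (1 - 1 / p) * nrm (lp_space p n) x)
        = nrm (lp_space p n) x"
      using n by (simp flip: mult.assoc powr_add)
    finally show ?thesis by (simp add: mult_left_mono)
  qed
  show "nrm (dual_space (lp_space p n)) (sign_functional p n s) \<le> 1"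
    by (rule dual_norm_le[OF homogeneous_lp[OF p]], rule order_trans[OF le]) simp_all
  have "linear_on (vecs (lp_space p n)) (sign_functional p n s)"
    by (auto simp: linear_on_def sign_functional_def sum.distrib sum_distrib_left algebra_simps)
  then show "sign_functional p n s \<in> vecs (dual_space (lp_space p n))"
    using le by (auto simp: dual_space_def sign_functional_def intro!: exI[of _ 1])
qed

text \<open>If \<open>u\<close> is written by columns as the sum of \<open>u\<^sub>j \<otimes> e\<^sub>j\<close>, then \<open>A \<otimes> id\<close> sends it to the sum of
  \<open>A u\<^sub>j \<otimes> e\<^sub>j\<close>. This is the representation from which the projective norm is estimated.\<close>

lemma tensor_map_id_lp:
  assumes A: "A \<in> linear_maps (lp_space p n) G"
    and u: "u \<in> tensors (vecs (lp_space p n)) (vecs (lp_space q m))"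
  shows "tensor_map G (lp_space q m) A id u
    = (\<Sum>j<m. elem_tensor (vecs G) (vecs (lp_space q m))
        (A (\<lambda>i. if i < n then u (\<lambda>x y. x i * y j) else 0)) (unit_vec j))"
proof (rule ext)
  fix B
  let ?V = "vecs (lp_space p n)" and ?W = "vecs (lp_space q m)"
  let ?c = "\<lambda>j i. if i < n then u (\<lambda>x y. x i * y j) else 0"
  show "tensor_map G (lp_space q m) A id u B
    = (\<Sum>j<m. elem_tensor (vecs G) ?W (A (?c j)) (unit_vec j)) B"
  proof (cases "bilinear_on (vecs G) ?W B")
    case True
    have BA: "bilinear_on ?V ?W (\<lambda>x y. B (A x) y)"
      using A True unfolding bilinear_on_def linear_maps_def linear_on_def
      by (auto simp: image_subset_iff)
    have "tensor_map G (lp_space q m) A id u B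
        = (\<Sum>i<n. \<Sum>j<m. u (\<lambda>x y. x i * y j) * B (A (unit_vec i)) (unit_vec j))"
      using True lp_tensor_expand[OF u BA] by (simp add: tensor_map_def)
    also have "\<dots> = (\<Sum>j<m. \<Sum>i<n. u (\<lambda>x y. x i * y j) * B (A (unit_vec i)) (unit_vec j))"
      by (rule sum.swap)
    also have "\<dots> = (\<Sum>j<m. B (A (?c j)) (unit_vec j))"
    proof (intro sum.cong refl)
      fix j assume "j \<in> {..<m}"
      then have "unit_vec j \<in> ?W" by (auto simp: unit_vec_def)
      then have "linear_on ?V (\<lambda>x. B (A x) (unit_vec j))"
        using BA by (auto simp: bilinear_on_def)
      from linear_on_lp_expand[OF this, of "?c j"]
      show "(\<Sum>i<n. u (\<lambda>x y. x i * y j) * B (A (unit_vec i)) (unit_vec j))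
          = B (A (?c j)) (unit_vec j)" by simp
    qed
    finally show ?thesis using True by (simp add: sum_fun_apply elem_tensor_def)
  next
    case False
    then show ?thesis by (simp add: tensor_map_def sum_fun_apply elem_tensor_def)
  qed
qed

section \<open>The upper bound\<close>

text \<open>Testing \<open>u\<close> on the normalised sign vectors \<open>s\<close> and \<open>t\<close>, with \<open>t j\<close> chosen as the sign of the
  pairing of \<open>s\<close> with column \<open>j\<close>, produces the sum of absolute values.\<close>

lemma inj_norm_signed_columns:
  assumes p: "1 \<le> p" and n: "n \<ge> 1"
    and u: "u \<in> tensors (vecs (lp_space p n)) (vecs (lp_space p n))"
    and inj: "nrm (inj_tensor (lp_space p n) (lp_space p n)) u \<le> 1"
    and s: "\<And>i. \<bar>s i\<bar> = 1"
  shows "(\<Sum>j<n. \<bar>\<Sum>i<n. s i * u (\<lambda>x y. x i * y j)\<bar>) \<le> real n powr (2 - 2 / p)"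
proof -
  let ?c = "\<lambda>i j. u (\<lambda>x y. x i * y j)"
  define a where "a = real n powr (1 / p - 1)"
  define t where "t j = (if (\<Sum>i<n. s i * ?c i j) \<ge> 0 then 1 else - 1 :: real)" for j
  let ?\<phi> = "sign_functional p n s" and ?\<psi> = "sign_functional p n t"
  have t: "\<bar>t j\<bar> = 1" for j by (simp add: t_def)
  have unit: "sign_functional p n r (unit_vec i) = a * r i" if "i < n" for r i
  proof -
    have "(\<Sum>k<n. r k * unit_vec i k) = (\<Sum>k<n. if k = i then r k else 0)"
      by (intro sum.cong) (auto simp: unit_vec_def)
    then show ?thesis using that by (auto simp: sign_functional_def a_def unit_vec_def)
  qed
  note \<phi> = sign_functional_dual[OF p n, of s, OF s] and \<psi> = sign_functional_dual[OF p n, of t, OF t]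
  have bil: "bilinear_on (vecs (lp_space p n)) (vecs (lp_space p n)) (\<lambda>x y. ?\<phi> x * ?\<psi> y)"
    using \<phi>(1) \<psi>(1) by (intro bilinear_on_functional_product) (auto simp: dual_space_def)
  have "a * a * (\<Sum>j<n. \<bar>\<Sum>i<n. s i * ?c i j\<bar>) = a * a * (\<Sum>j<n. t j * (\<Sum>i<n. s i * ?c i j))"
    by (intro arg_cong2[where f = "(*)"] sum.cong refl) (simp add: t_def)
  also have "\<dots> = (\<Sum>j<n. \<Sum>i<n. ?c i j * (?\<phi> (unit_vec i) * ?\<psi> (unit_vec j)))"
    by (simp add: unit sum_distrib_left mult_ac)
  also have "\<dots> = u (\<lambda>x y. ?\<phi> x * ?\<psi> y)"
    unfolding lp_tensor_expand[OF u bil] by (rule sum.swap)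
  also have "\<dots> \<le> 1"
    using inj_norm_ge[OF p p u \<phi> \<psi>] inj by simp
  finally have "a * a * (\<Sum>j<n. \<bar>\<Sum>i<n. s i * ?c i j\<bar>) \<le> 1" .
  then have "real n powr (2 - 2 / p) * (a * a * (\<Sum>j<n. \<bar>\<Sum>i<n. s i * ?c i j\<bar>))
      \<le> real n powr (2 - 2 / p) * 1"
    by (intro mult_left_mono) auto
  moreover have "real n powr (2 - 2 / p) * (a * a) = 1"
    using n by (simp add: a_def powr_add[symmetric])
  ultimately show ?thesis by (simp flip: mult.assoc)
qed

text \<open>Averaging the preceding bound over all signs and applying the Khintchine inequality to each
  column.\<close>

lemma inj_norm_l2_columns:
  assumes p: "1 \<le> p" and n: "n \<ge> 1"
    and u: "u \<in> tensors (vecs (lp_space p n)) (vecs (lp_space p n))"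
    and inj: "nrm (inj_tensor (lp_space p n) (lp_space p n)) u \<le> 1"
  shows "(\<Sum>j<n. sqrt (\<Sum>i<n. (u (\<lambda>x y. x i * y j))\<^sup>2)) \<le> 9 / 5 * real n powr (2 - 2 / p)"
proof -
  let ?c = "\<lambda>i j. u (\<lambda>x y. x i * y j)"
  have "(\<Sum>j<n. sqrt (\<Sum>i<n. (?c i j)\<^sup>2))
      \<le> (\<Sum>j<n. 9 / 5 * rademacher_mean n (\<lambda>s. \<bar>\<Sum>i<n. s i * ?c i j\<bar>))"
    by (intro sum_mono khintchine_L1)
  also have "\<dots> = 9 / 5 * rademacher_mean n (\<lambda>s. \<Sum>j<n. \<bar>\<Sum>i<n. s i * ?c i j\<bar>)"
    by (simp add: rademacher_mean_sum sum_distrib_left)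
  also have "\<dots> \<le> 9 / 5 * rademacher_mean n (\<lambda>s. real n powr (2 - 2 / p))"
    by (intro mult_left_mono rademacher_mean_mono inj_norm_signed_columns[OF p n u inj]) auto
  finally show ?thesis by (simp add: rademacher_mean_const)
qed

lemma proj_norm_tensor_map_lp_le:
  assumes p: "1 \<le> p" "p < 2" and n: "n \<ge> 1"
    and A: "A \<in> linear_maps (lp_space p n) (dual_space (lp_space p n))"
    and op: "op_norm (lp_space p n) (dual_space (lp_space p n)) A \<le> 1"
    and u: "u \<in> tensors (vecs (lp_space p n)) (vecs (lp_space p n))"
    and inj: "nrm (inj_tensor (lp_space p n) (lp_space p n)) u \<le> 1"
  shows "nrm (proj_tensor (dual_space (lp_space p n)) (lp_space p n))
      (tensor_map (dual_space (lp_space p n)) (lp_space p n) A id u)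
    \<le> 9 / 5 * real n powr (3 / 2 - 1 / p)"
proof -
  let ?E = "lp_space p n"
  let ?c = "\<lambda>j i. if i < n then u (\<lambda>x y. x i * y j) else 0"
  note E = homogeneous_lp[OF p(1), of n]
  have c: "?c j \<in> vecs ?E" for j by simp
  have "nrm (proj_tensor (dual_space ?E) ?E) (tensor_map (dual_space ?E) ?E A id u)
      \<le> (\<Sum>j<n. nrm (dual_space ?E) (A (?c j)) * nrm ?E (unit_vec j))"
    unfolding tensor_map_id_lp[OF A u]
  proof (rule proj_norm_le)
    show "A (?c j) \<in> vecs (dual_space ?E)" for j
      using A c[of j] by (auto simp: linear_maps_def)
  qed (auto intro: dual_norm_nonneg[OF E] homogeneous_norm_nonneg[OF E] simp: unit_vec_def)
  also have "\<dots> \<le> (\<Sum>j<n. nrm ?E (?c j))"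
    by (intro sum_mono) (simp add: unit_vec_lp(2)[OF p(1)] op_norm_le_oneD[OF E A op c])
  also have "\<dots> \<le> (\<Sum>j<n. real n powr (1 / p - 1 / 2) * sqrt (\<Sum>i<n. (u (\<lambda>x y. x i * y j))\<^sup>2))"
    using lp_le_l2[OF p, of n "?c _"] by (intro sum_mono) simp
  also have "\<dots> \<le> real n powr (1 / p - 1 / 2) * (9 / 5 * real n powr (2 - 2 / p))"
    unfolding sum_distrib_left[symmetric]
    by (intro mult_left_mono inj_norm_l2_columns p n u inj) auto
  also have "\<dots> = 9 / 5 * real n powr ((1 / p - 1 / 2) + (2 - 2 / p))"
    unfolding powr_add by simp
  also have "(1 / p - 1 / 2) + (2 - 2 / p) = 3 / 2 - 1 / p"
    by simp
  finally show ?thesis .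
qed

lemma vecs_inj_tensor: "vecs (inj_tensor E F) = tensors (vecs E) (vecs F)"
  by (simp add: inj_tensor_def)

lemma K_G_lp_upper:
  assumes "1 \<le> p" "p < 2" "n \<ge> 1"
  shows "K_G (lp_space p n) (lp_space p n) \<le> ennreal (9 / 5 * real n powr (3 / 2 - 1 / p))"
  unfolding K_G_def op_norm_def[of "inj_tensor _ _"]
  by (intro SUP_least ennreal_leI proj_norm_tensor_map_lp_le assms) (simp_all add: vecs_inj_tensor)

section \<open>The lower bound\<close>

definition matrix_map :: "real \<Rightarrow> nat \<Rightarrow> (nat \<Rightarrow> nat \<Rightarrow> real) \<Rightarrow> (nat \<Rightarrow> real) \<Rightarrow> (nat \<Rightarrow> real) \<Rightarrow> real" where
  "matrix_map p n a x = (\<lambda>y. if y \<in> vecs (lp_space p n)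
     then \<Sum>i<n. \<Sum>j<n. a i j * x i * y j else 0)"

lemma matrix_map_linear:
  assumes p: "p \<ge> 1"
  shows "matrix_map p n a \<in> linear_maps (lp_space p n) (dual_space (lp_space p n))"
proof -
  let ?E = "lp_space p n"
  have "linear_on (vecs ?E) (matrix_map p n a)"
    by (auto simp: linear_on_def matrix_map_def fun_eq_iff sum.distrib sum_distrib_left algebra_simps)
  moreover have "matrix_map p n a x \<in> vecs (dual_space ?E)" for x
  proof -
    have "linear_on (vecs ?E) (matrix_map p n a x)"
      by (auto simp: linear_on_def matrix_map_def sum.distrib sum_distrib_left algebra_simps)
    moreover have "\<bar>matrix_map p n a x y\<bar> \<le> (\<Sum>i<n. \<Sum>j<n. \<bar>a i j * x i\<bar>) * nrm ?E y"
      if "y \<in> vecs ?E" for y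
    proof -
      have "\<bar>matrix_map p n a x y\<bar> \<le> (\<Sum>i<n. \<Sum>j<n. \<bar>a i j * x i * y j\<bar>)"
        unfolding matrix_map_def if_P[OF that]
        by (rule order_trans[OF sum_abs], intro sum_mono, rule sum_abs)
      also have "\<dots> \<le> (\<Sum>i<n. \<Sum>j<n. \<bar>a i j * x i\<bar> * nrm ?E y)"
        unfolding abs_mult[of _ "y _"] using coord_le_lp_norm[OF p]
        by (intro sum_mono mult_left_mono) auto
      finally show ?thesis by (simp add: sum_distrib_right)
    qed
    moreover have "matrix_map p n a x y = 0" if "y \<notin> vecs ?E" for y
      using that by (simp only: matrix_map_def if_False)
    ultimately show ?thesis
      unfolding dual_space_def nspace.simps by blast
  qed
  ultimately show ?thesis by (auto simp: linear_maps_def)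
qed

definition matrix_tensor :: "real \<Rightarrow> nat \<Rightarrow> (nat \<Rightarrow> nat \<Rightarrow> real) \<Rightarrow> (nat \<Rightarrow> real, nat \<Rightarrow> real) tensor" where
  "matrix_tensor p n a = (\<Sum>i<n. \<Sum>j<n. a i j *\<^sub>R
     elem_tensor (vecs (lp_space p n)) (vecs (lp_space p n)) (unit_vec i) (unit_vec j))"

lemma matrix_tensor_in_tensors:
  "matrix_tensor p n a \<in> tensors (vecs (lp_space p n)) (vecs (lp_space p n))"
  unfolding matrix_tensor_def tensors_def
  by (intro span_sum span_scale span_base CollectI exI conjI refl) (auto simp: unit_vec_def)

lemma matrix_tensor_apply:
  assumes "bilinear_on (vecs (lp_space p n)) (vecs (lp_space p n)) B"
  shows "matrix_tensor p n a B = (\<Sum>i<n. \<Sum>j<n. a i j * B (unit_vec i) (unit_vec j))"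
  using assms by (simp add: matrix_tensor_def sum_fun_apply elem_tensor_def)

text \<open>The dual norm of \<open>\<phi>\<close> is tested on its own vector of coefficients, whose \<open>\<ell>\<^sub>p\<close> norm is
  comparable to its \<open>\<ell>\<^sub>2\<close> norm.\<close>

lemma dual_ball_l2_norm:
  assumes p: "1 \<le> p" "p < 2"
    and \<phi>: "\<phi> \<in> vecs (dual_space (lp_space p n))" "nrm (dual_space (lp_space p n)) \<phi> \<le> 1"
  shows "sqrt (\<Sum>i<n. (\<phi> (unit_vec i))\<^sup>2) \<le> real n powr (1 / p - 1 / 2)"
proof -
  let ?E = "lp_space p n"
  note E = homogeneous_lp[OF p(1), of n]
  define x where "x i = (if i < n then \<phi> (unit_vec i) else 0)" for i
  define r where "r = sqrt (\<Sum>i<n. (\<phi> (unit_vec i))\<^sup>2)"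
  have x: "x \<in> vecs ?E" by (simp add: x_def)
  have r0: "r \<ge> 0" and r2: "r\<^sup>2 = (\<Sum>i<n. (\<phi> (unit_vec i))\<^sup>2)"
    by (auto simp: r_def sum_nonneg)
  have "r\<^sup>2 = \<phi> x"
    using linear_on_lp_expand[OF _ x, of \<phi>] \<phi>(1)
    by (simp add: r2 x_def dual_space_def flip: power2_eq_square)
  also have "\<dots> \<le> nrm (dual_space ?E) \<phi> * nrm ?E x"
    using dual_norm_bound[OF E \<phi>(1) x] by simp
  also have "\<dots> \<le> 1 * nrm ?E x"
    using \<phi>(2) homogeneous_norm_nonneg[OF E x] by (intro mult_right_mono)
  also have "nrm ?E x \<le> real n powr (1 / p - 1 / 2) * sqrt (\<Sum>i<n. (x i)\<^sup>2)"
    by (rule lp_le_l2[OF p])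
  also have "sqrt (\<Sum>i<n. (x i)\<^sup>2) = r"
    by (simp add: x_def r_def)
  finally have "r * r \<le> real n powr (1 / p - 1 / 2) * r"
    by (simp add: power2_eq_square)
  then show ?thesis
    using r0 unfolding r_def[symmetric] by (cases "r = 0") auto
qed

text \<open>The operator and the tensor are both multiples of the Hartley matrix \<open>H\<close>. The multiple \<open>\<alpha>\<close> for
  the operator is the inverse of the Hausdorff--Young bound. For the tensor, a pair of functionals in the
  dual ball has \<open>\<ell>\<^sub>2\<close> norms at most \<open>n powr (1 / p - 1 / 2)\<close>, and \<open>H\<close> has norm \<open>sqrt n\<close> on \<open>\<ell>\<^sub>2\<close>, so
  \<open>\<beta> = n powr (1 / 2 - 2 / p)\<close> normalises it. The projective norm of the image is at least its value on the
  duality pairing, the trace \<open>\<alpha> \<beta> tr (H\<^sup>2) = \<alpha> \<beta> n\<^sup>2\<close>, which is a constant multiple of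
  \<open>n powr (3 / 2 - 1 / p)\<close>.\<close>

lemma K_G_lp_lower:
  assumes p: "1 \<le> p" "p < 2" and n: "n \<ge> 1"
  shows "ennreal (1 / (3 + 1 / (2 * (1 - 2 powr (p - 2)))) * real n powr (3 / 2 - 1 / p))
    \<le> K_G (lp_space p n) (lp_space p n)"
proof -
  let ?E = "lp_space p n" and ?h = "hartley n"
  note E = homogeneous_lp[OF p(1), of n]
  define C where "C = 3 + 1 / (2 * (1 - 2 powr (p - 2)))"
  define \<alpha> where "\<alpha> = real n powr (1 / p - 1) / C"
  define \<beta> where "\<beta> = real n powr (1 / 2 - 2 / p)"
  define A where "A = matrix_map p n (\<lambda>i j. \<alpha> * ?h i j)"
  define u where "u = matrix_tensor p n (\<lambda>i j. \<beta> * ?h i j)"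
  have "2 powr (p - 2) < 1"
    using powr_less_mono[of "p - 2" 0 "2::real"] p by simp
  then have C: "C > 0" by (simp add: C_def add_pos_pos)
  have \<alpha>0: "\<alpha> \<ge> 0" and \<beta>0: "\<beta> \<ge> 0" using C by (auto simp: \<alpha>_def \<beta>_def)
  have A: "A \<in> linear_maps ?E (dual_space ?E)"
    unfolding A_def by (rule matrix_map_linear[OF p(1)])
  have u: "u \<in> tensors (vecs ?E) (vecs ?E)"
    unfolding u_def by (rule matrix_tensor_in_tensors)

  have A_op: "op_norm ?E (dual_space ?E) A \<le> 1"
  proof -
    have "nrm (dual_space ?E) (A x) \<le> 1" if x: "x \<in> vecs ?E" "nrm ?E x \<le> 1" for x
    proof (rule dual_norm_le[OF E])
      fix y assume y: "y \<in> vecs ?E" "nrm ?E y \<le> 1"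
      have "\<bar>A x y\<bar> = \<alpha> * \<bar>\<Sum>i<n. \<Sum>j<n. ?h i j * x i * y j\<bar>"
        using y \<alpha>0 by (simp add: A_def matrix_map_def mult.assoc sum_distrib_left[symmetric] abs_mult)
      also have "\<dots> \<le> \<alpha> * (C * real n powr (1 - 1 / p))"
      proof (rule mult_left_mono[OF _ \<alpha>0])
        show "\<bar>\<Sum>i<n. \<Sum>j<n. ?h i j * x i * y j\<bar> \<le> C * real n powr (1 - 1 / p)"
          using bilinear_form_bound[OF p n abs_hartley_le eq_refl[OF hartley_parseval]
              lp_norm_le_oneD[OF p(1) x(2)] lp_norm_le_oneD[OF p(1) y(2)]]
          by (simp add: C_def)
      qed
      also have "\<dots> = 1"
        using C n by (simp add: \<alpha>_def powr_add[symmetric])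
      finally show "\<bar>A x y\<bar> \<le> 1" .
    qed
    then show ?thesis
      unfolding op_norm_def by (intro SUP_least) auto
  qed

  have u_inj: "nrm (inj_tensor ?E ?E) u \<le> 1"
  proof -
    have le: "\<bar>u (\<lambda>x y. \<phi> x * \<psi> y)\<bar> \<le> 1"
      if \<phi>: "\<phi> \<in> vecs (dual_space ?E)" "nrm (dual_space ?E) \<phi> \<le> 1"
        and \<psi>: "\<psi> \<in> vecs (dual_space ?E)" "nrm (dual_space ?E) \<psi> \<le> 1" for \<phi> \<psi>
    proof -
      define f g where "f i = \<phi> (unit_vec i)" and "g i = \<psi> (unit_vec i)" for i
      have "bilinear_on (vecs ?E) (vecs ?E) (\<lambda>x y. \<phi> x * \<psi> y)"
        using \<phi>(1) \<psi>(1) by (intro bilinear_on_functional_product) (auto simp: dual_space_def)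
      then have "u (\<lambda>x y. \<phi> x * \<psi> y) = (\<Sum>i<n. \<Sum>j<n. \<beta> * ?h i j * (f i * g j))"
        by (simp add: u_def matrix_tensor_apply f_def g_def)
      also have "\<dots> = (\<Sum>j<n. \<Sum>i<n. \<beta> * ?h i j * (f i * g j))"
        by (rule sum.swap)
      also have "\<dots> = \<beta> * (\<Sum>j<n. (\<Sum>i<n. ?h i j * f i) * g j)"
        by (simp add: sum_distrib_left sum_distrib_right mult_ac)
      finally have "\<bar>u (\<lambda>x y. \<phi> x * \<psi> y)\<bar> = \<beta> * \<bar>\<Sum>j<n. (\<Sum>i<n. ?h i j * f i) * g j\<bar>"
        using \<beta>0 by (simp add: abs_mult)
      also have "\<bar>\<Sum>j<n. (\<Sum>i<n. ?h i j * f i) * g j\<bar>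
          \<le> sqrt ((\<Sum>j<n. (\<Sum>i<n. ?h i j * f i)\<^sup>2) * (\<Sum>j<n. (g j)\<^sup>2))"
        by (rule real_le_rsqrt) (simp add: Cauchy_Schwarz_ineq_sum)
      also have "\<dots> = sqrt (real n) * sqrt (\<Sum>i<n. (f i)\<^sup>2) * sqrt (\<Sum>j<n. (g j)\<^sup>2)"
        by (simp add: hartley_parseval real_sqrt_mult)
      also have "\<dots> \<le> sqrt (real n) * real n powr (1 / p - 1 / 2) * real n powr (1 / p - 1 / 2)"
        unfolding f_def g_def using dual_ball_l2_norm[OF p \<phi>] dual_ball_l2_norm[OF p \<psi>]
        by (intro mult_mono mult_left_mono) (auto intro!: sum_nonneg)
      also have "\<beta> * (sqrt (real n) * real n powr (1 / p - 1 / 2) * real n powr (1 / p - 1 / 2))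
          = real n powr ((1 / 2 - 2 / p) + (1 / 2 + (1 / p - 1 / 2) + (1 / p - 1 / 2)))"
        unfolding powr_add by (simp add: \<beta>_def powr_half_sqrt)
      also have "\<dots> = 1"
        using n by simp
      finally show ?thesis using \<beta>0 by (simp add: mult_left_mono)
    qed
    show ?thesis
      unfolding inj_tensor_def nspace.simps
    proof (rule cSup_least)
      show "{\<bar>u (\<lambda>x y. \<phi> x * \<psi> y)\<bar> | \<phi> \<psi>.
          \<phi> \<in> vecs (dual_space ?E) \<and> nrm (dual_space ?E) \<phi> \<le> 1 \<and>
          \<psi> \<in> vecs (dual_space ?E) \<and> nrm (dual_space ?E) \<psi> \<le> 1} \<noteq> {}"
        unfolding ex_in_conv[symmetric]
        by (intro exI[of _ "\<bar>u (\<lambda>x y. 0 * 0)\<bar>"] CollectI exI[of _ "\<lambda>_. 0"] conjI refl zero_in_dual_space[OF E]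
            order_trans[OF zero_in_dual_space(2)[OF E]] zero_le_one)
    qed (elim CollectE exE conjE, simp add: le)
  qed

  have "\<alpha> * \<beta> * (real n * real n) \<le> nrm (proj_tensor (dual_space ?E) ?E) (tensor_map (dual_space ?E) ?E A id u)"
  proof -
    have A_unit: "A (unit_vec i) (unit_vec j) = \<alpha> * ?h i j" if "i < n" "j < n" for i j
    proof -
      have "(\<Sum>k<n. \<Sum>l<n. \<alpha> * ?h k l * unit_vec i k * unit_vec j l)
          = (\<Sum>k<n. \<Sum>l<n. if l = j then (if k = i then \<alpha> * ?h k l else 0) else 0)"
        by (intro sum.cong) (auto simp: unit_vec_def)
      then show ?thesis
        using that by (simp add: A_def matrix_map_def) (auto simp: unit_vec_def)
    qed
    have bil: "bilinear_on (vecs ?E) (vecs ?E) (\<lambda>x y. A x y)"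
      using A bilinear_dual_pairing[of ?E] unfolding bilinear_on_def linear_maps_def linear_on_def
      by (auto simp: image_subset_iff)
    have "tensor_map (dual_space ?E) ?E A id u (\<lambda>f y. f y)
        = (\<Sum>i<n. \<Sum>j<n. \<beta> * ?h i j * A (unit_vec i) (unit_vec j))"
      using bilinear_dual_pairing[of ?E] matrix_tensor_apply[OF bil]
      by (simp add: tensor_map_def u_def)
    also have "\<dots> = \<alpha> * \<beta> * (\<Sum>i<n. \<Sum>j<n. ?h i j * ?h i j)"
      by (simp add: A_unit sum_distrib_left mult_ac)
    also have "\<dots> = \<alpha> * \<beta> * (real n * real n)"
      by (simp add: hartley_orthogonal)
    finally have "tensor_map (dual_space ?E) ?E A id u (\<lambda>f y. f y) = \<alpha> * \<beta> * (real n * real n)" .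
    moreover have "tensor_map (dual_space ?E) ?E A id u (\<lambda>f y. f y)
        \<le> nrm (proj_tensor (dual_space ?E) ?E) (tensor_map (dual_space ?E) ?E A id u)"
    proof (rule proj_norm_ge[OF _ _ tensor_map_id_lp[OF A u] bilinear_dual_pairing])
      show "A (\<lambda>i. if i < n then u (\<lambda>x y. x i * y j) else 0) \<in> vecs (dual_space ?E)" for j
        using A by (auto simp: linear_maps_def image_subset_iff)
      show "f y \<le> nrm (dual_space ?E) f * nrm ?E y"
        if "f \<in> vecs (dual_space ?E)" "y \<in> vecs ?E" for f y
        using dual_norm_bound[OF E that] by simp
    qed (simp add: unit_vec_def)
    ultimately show ?thesis by simp
  qed
  also have "\<alpha> * \<beta> * (real n * real n) = 1 / C * real n powr ((1 / p - 1) + (1 / 2 - 2 / p) + (1 + 1))"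
    unfolding powr_add using n by (simp add: \<alpha>_def \<beta>_def)
  also have "(1 / p - 1) + (1 / 2 - 2 / p) + (1 + 1) = 3 / 2 - 1 / p"
    by simp
  finally have "ennreal (1 / C * real n powr (3 / 2 - 1 / p))
      \<le> ennreal (nrm (proj_tensor (dual_space ?E) ?E) (tensor_map (dual_space ?E) ?E A id u))"
    by (rule ennreal_leI)
  also have "\<dots> \<le> op_norm (inj_tensor ?E ?E) (proj_tensor (dual_space ?E) ?E)
      (tensor_map (dual_space ?E) ?E A id)"
    unfolding op_norm_def using u u_inj by (intro SUP_upper) (simp add: vecs_inj_tensor)
  also have "\<dots> \<le> K_G ?E ?E"
    unfolding K_G_def using A A_op by (intro SUP_upper) auto
  finally show ?thesis by (simp only: C_def)
qed

section \<open>The order of growth\<close>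

theorem corollary4p18:
  fixes p :: real
  assumes "1 \<le> p" and "p < 2"
  shows "\<exists>c C :: real. 0 < c \<and> 0 < C \<and>
    (\<forall>n::nat. n \<ge> 1 \<longrightarrow>
       ennreal (c * real n powr (3 / 2 - 1 / p)) \<le> K_G (lp_space p n) (lp_space p n) \<and>
       K_G (lp_space p n) (lp_space p n) \<le> ennreal (C * real n powr (3 / 2 - 1 / p)))"
proof (intro exI conjI allI impI)
  have "2 powr (p - 2) < 1"
    using powr_less_mono[of "p - 2" 0 "2::real"] assms by simp
  then show "0 < 1 / (3 + 1 / (2 * (1 - 2 powr (p - 2))))"
    by (simp add: add_pos_pos)
  show "(0::real) < 9 / 5" by simp
  fix n :: nat
  assume "n \<ge> 1"
  show "ennreal (1 / (3 + 1 / (2 * (1 - 2 powr (p - 2)))) * real n powr (3 / 2 - 1 / p))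
      \<le> K_G (lp_space p n) (lp_space p n)"
    by (rule K_G_lp_lower) fact+
  show "K_G (lp_space p n) (lp_space p n) \<le> ennreal (9 / 5 * real n powr (3 / 2 - 1 / p))"
    by (rule K_G_lp_upper) fact+
qed

end
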